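(* For every bipartite graph $H$ with $\gamma(H) > 1$, every $H$-free graph $G$ has a minor $J$ with $$\mathrm{d}(J) \geq (\mathrm{d}(G))^{\frac{\gamma(H)}{2(\gamma(H)-1)}-o_{\mathrm{d}(G)}(1)}.$$
   Context: All graphs are finite and simple; $\mathrm{d}(G)=|E(G)|/|V(G)|$ is the density. $G$ is $H$-free if no subgraph of $G$ is isomorphic to $H$. The Turán number $\operatorname{ex}(n,H)$ is the maximum number of edges in an $H$-free graph on $n$ vertices, and the Turán exponent is $\gamma(H)=\limsup_{n\to\infty}\frac{\log \operatorname{ex}(n,H)}{\log n}$. The term $o_{\mathrm{d}(G)}(1)$ tends to $0$ as $\mathrm{d}(G)\to\infty$ (with $H$ fixed). *)

theory Defs
  imports Complex_Main "HOL-Library.Extended_Real" "HOL-Library.Liminf_Limsup"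
    "HOL-Library.Disjoint_Sets"
begin

record 'a ugraph =
  verts :: "'a set"
  edges :: "'a set set"

definition simple_graph :: "'a ugraph \<Rightarrow> bool" where
  "simple_graph G \<longleftrightarrow>
     finite (verts G) \<and>
     edges G \<subseteq> {{u, v} | u v. u \<in> verts G \<and> v \<in> verts G \<and> u \<noteq> v}"

definition graph_density :: "'a ugraph \<Rightarrow> real" where
  "graph_density G = real (card (edges G)) / real (card (verts G))"

definition bipartite :: "'a ugraph \<Rightarrow> bool" where
  "bipartite G \<longleftrightarrow>
     (\<exists>A B. A \<union> B = verts G \<and> A \<inter> B = {} \<and>
        edges G \<subseteq> {{a, b} | a b. a \<in> A \<and> b \<in> B})"

definition subgraph :: "'a ugraph \<Rightarrow> 'a ugraph \<Rightarrow> bool" where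
  "subgraph K G \<longleftrightarrow> simple_graph K \<and> verts K \<subseteq> verts G \<and> edges K \<subseteq> edges G"

definition isomorphic :: "'a ugraph \<Rightarrow> 'b ugraph \<Rightarrow> bool" where
  "isomorphic G H \<longleftrightarrow>
     (\<exists>\<phi>. bij_betw \<phi> (verts G) (verts H) \<and>
        (\<forall>u \<in> verts G. \<forall>v \<in> verts G. {u, v} \<in> edges G \<longleftrightarrow> {\<phi> u, \<phi> v} \<in> edges H))"

definition graph_free :: "'a ugraph \<Rightarrow> 'b ugraph \<Rightarrow> bool" where
  "graph_free H G \<longleftrightarrow> \<not> (\<exists>K. subgraph K G \<and> isomorphic K H)"

text \<open>The set below is a finite set of natural numbers, so its supremum is its maximum; it is
  \<open>0\<close> in the degenerate case that no \<open>H\<close>-free graph on \<open>n\<close> vertices exists. Every finite graph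
  is isomorphic to one whose vertices are natural numbers.\<close>

definition turan_number :: "nat \<Rightarrow> 'a ugraph \<Rightarrow> nat" where
  "turan_number n H =
     Sup {card (edges G) | G :: nat ugraph.
            simple_graph G \<and> card (verts G) = n \<and> graph_free H G}"

text \<open>For \<open>n \<ge> 2\<close> the quotient lies between \<open>0\<close> and \<open>2\<close> (as \<open>ln 0 = 0\<close>), hence the limit
  superior is finite and \<open>real_of_ereal\<close> loses nothing.\<close>

definition turan_exponent :: "'a ugraph \<Rightarrow> real" where
  "turan_exponent H =
     real_of_ereal
       (limsup (\<lambda>n. ereal (ln (real (turan_number n H)) / ln (real n))))"

definition connected_in :: "'a ugraph \<Rightarrow> 'a set \<Rightarrow> bool" where
  "connected_in G S \<longleftrightarrow>
     S \<noteq> {} \<and> S \<subseteq> verts G \<and>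
     (\<forall>u \<in> S. \<forall>v \<in> S. (u, v) \<in> {(x, y). x \<in> S \<and> y \<in> S \<and> {x, y} \<in> edges G}\<^sup>*)"

text \<open>\<open>B x\<close> is the branch set that is contracted to the vertex \<open>x\<close> of the minor.\<close>

definition is_minor :: "'a ugraph \<Rightarrow> 'b ugraph \<Rightarrow> bool" where
  "is_minor J G \<longleftrightarrow>
     (\<exists>B. (\<forall>x \<in> verts J. connected_in G (B x)) \<and>
        disjoint_family_on B (verts J) \<and>
        (\<forall>x y. {x, y} \<in> edges J \<longrightarrow> (\<exists>u \<in> B x. \<exists>v \<in> B y. {u, v} \<in> edges G)))"

end

theory Submission
  imports Defs
begin

text \<open>
  Let \<open>d\<close> be the density of \<open>G\<close>. Being \<open>H\<close>-free, \<open>G\<close> has no subgraph of density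
  \<open>d\<^bsup>1-o(1)\<^esup>\<close> on fewer than \<open>N = d\<^bsup>1/(\<gamma>-1)-o(1)\<^esup>\<close> vertices. Contract \<open>G\<close> in rounds. When the
  branch sets have size at most \<open>M\<close>, every set of at most \<open>N/M\<close> vertices of the contracted graph
  spans density at most \<open>M\<close> times the original local bound, since it can be pulled back to \<open>G\<close>. This
  local sparseness makes neighbourhoods of most pairs of vertices nearly disjoint, so stars can be chosen
  whose contraction creates few parallel edges: a round multiplies the branch set size by some
  \<open>g \<ge> 2\<close> and the density by at least \<open>g\<^bsup>1-\<epsilon>\<^esup>\<close>. The rounds continue until \<open>M\<close> is about \<open>(N/d)\<^bsup>1/2\<^esup>\<close>,
  when the density is \<open>(N d)\<^bsup>1/2-o(1)\<^esup> = d\<^bsup>\<gamma>/(2(\<gamma>-1))-o(1)\<^esup>\<close>.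

  In a round there are two cases. If vertices of huge degree (hubs) carry many edges, they serve as
  centres, and the far more numerous remaining vertices are distributed over them as evenly as
  possible, by a list colouring in which vertices with large common neighbourhoods get different
  centres. Otherwise the graph is almost regular, and a first contraction of a maximal family of
  disjoint stars produces a similarly unbalanced situation.
\<close>

section \<open>Counting\<close>

lemma card_UN_Bonferroni:
  fixes A :: "'x \<Rightarrow> 'y set" and \<eta> :: real
  assumes "finite Z" and "\<And>x. x \<in> Z \<Longrightarrow> finite (A x)"
    and "\<And>x y. \<lbrakk>x \<in> Z; y \<in> Z; x \<noteq> y\<rbrakk> \<Longrightarrow> card (A x \<inter> A y) \<le> \<eta>"
    and "0 \<le> \<eta>"
  shows "(\<Sum>x\<in>Z. real (card (A x))) - (card Z)\<^sup>2 * \<eta> \<le> card (\<Union>x\<in>Z. A x)"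
  using assms(1-3)
proof (induction Z rule: finite_induct)
  case (insert z Z)
  let ?U = "\<Union>x\<in>Z. A x"
  have "card (A z \<inter> ?U) \<le> (\<Sum>x\<in>Z. card (A z \<inter> A x))"
    using card_UN_le[OF insert.hyps(1), of "\<lambda>x. A z \<inter> A x"] by simp
  then have "real (card (A z \<inter> ?U)) \<le> (\<Sum>x\<in>Z. real (card (A z \<inter> A x)))"
    by (metis of_nat_mono of_nat_sum)
  also have "\<dots> \<le> (\<Sum>x\<in>Z. \<eta>)"
    using insert.hyps(2) by (intro sum_mono insert.prems(2)) auto
  finally have overlap: "card (A z \<inter> ?U) \<le> card Z * \<eta>" by simp
  have "card (A z) + card ?U = card (A z \<union> ?U) + card (A z \<inter> ?U)"
    using insert by (intro card_Un_Int) auto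
  then have "real (card (A z)) + card ?U = card (A z \<union> ?U) + card (A z \<inter> ?U)"
    by (metis of_nat_add)
  moreover have "(\<Sum>x\<in>Z. real (card (A x))) - (card Z)\<^sup>2 * \<eta> \<le> card ?U"
    using insert by auto
  moreover have "(card (insert z Z))\<^sup>2 * \<eta> = (card Z)\<^sup>2 * \<eta> + 2 * (card Z * \<eta>) + \<eta>"
    using insert.hyps by (simp add: power2_eq_square algebra_simps)
  moreover have "0 \<le> card Z * \<eta>" using assms(4) by simp
  ultimately show ?case using overlap insert.hyps assms(4) by simp
qed simp

lemma card_Int_Times:
  assumes "finite A" "finite E"
  shows "card (E \<inter> A \<times> B) = (\<Sum>a\<in>A. card (E `` {a} \<inter> B))"
proof -
  have "E \<inter> A \<times> B = (SIGMA a:A. E `` {a} \<inter> B)" by auto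
  moreover have "finite (E `` {a} \<inter> B)" for a using assms(2) by (simp add: finite_Image)
  ultimately show ?thesis using assms by simp
qed

lemma card_Int_Times_sym:
  assumes "sym E"
  shows "card (E \<inter> A \<times> B) = card (E \<inter> B \<times> A)"
proof -
  have "(E \<inter> A \<times> B)\<inverse> = E \<inter> B \<times> A" using assms by (auto dest: symD)
  then show ?thesis by (metis card_inverse)
qed

lemma card_Int_Times_ge:
  fixes d :: real
  assumes "finite A" "finite E" "\<And>a. a \<in> A \<Longrightarrow> d \<le> card (E `` {a} \<inter> B)"
  shows "card A * d \<le> card (E \<inter> A \<times> B)"
  unfolding card_Int_Times[OF assms(1,2)] of_nat_sum using assms(3) by (rule sum_bounded_below)

lemma card_Int_Times_le:
  fixes D :: real
  assumes "finite A" "finite E" "\<And>a. a \<in> A \<Longrightarrow> card (E `` {a}) \<le> D"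
  shows "card (E \<inter> A \<times> B) \<le> card A * D"
  unfolding card_Int_Times[OF assms(1,2)] of_nat_sum
proof (rule sum_bounded_above)
  fix a assume "a \<in> A"
  have "card (E `` {a} \<inter> B) \<le> card (E `` {a})"
    using assms(2) by (intro card_mono) (auto simp: finite_Image)
  then show "card (E `` {a} \<inter> B) \<le> D" using assms(3)[OF \<open>a \<in> A\<close>] by linarith
qed

lemma card_le_by_degrees:
  fixes d D :: real
  assumes "finite A" "finite B" "finite E" "sym E" "\<And>a. a \<in> A \<Longrightarrow> E `` {a} \<subseteq> B"
    and "\<And>a. a \<in> A \<Longrightarrow> d \<le> card (E `` {a})" "\<And>b. b \<in> B \<Longrightarrow> card (E `` {b}) \<le> D"
  shows "card A * d \<le> card B * D"
proof -
  have "card A * d \<le> card (E \<inter> A \<times> B)"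
    using assms(1,3,5,6) by (intro card_Int_Times_ge) (simp_all add: Int_absorb2)
  also have "\<dots> = card (E \<inter> B \<times> A)" using card_Int_Times_sym[OF assms(4)] by simp
  also have "\<dots> \<le> card B * D" using assms(2,3,7) by (rule card_Int_Times_le)
  finally show ?thesis .
qed

lemma card_Int_Times_le_heavy:
  fixes c :: real
  assumes "finite A" "finite E" "0 \<le> c"
  shows "card (E \<inter> A \<times> B) \<le> card (E \<inter> {a \<in> A. c \<le> card (E `` {a} \<inter> B)} \<times> B) + card A * c"
proof -
  define X where "X = {a \<in> A. c \<le> card (E `` {a} \<inter> B)}"
  have "E \<inter> A \<times> B = E \<inter> X \<times> B \<union> E \<inter> (A - X) \<times> B" unfolding X_def by auto
  then have "card (E \<inter> A \<times> B) \<le> card (E \<inter> X \<times> B) + card (E \<inter> (A - X) \<times> B)"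
    by (metis card_Un_le)
  moreover have "card (E \<inter> (A - X) \<times> B) \<le> card A * c"
  proof -
    have "real (card (E \<inter> (A - X) \<times> B)) = (\<Sum>a\<in>A - X. real (card (E `` {a} \<inter> B)))"
      using assms by (simp add: card_Int_Times)
    also have "\<dots> \<le> card (A - X) * c" unfolding X_def by (intro sum_bounded_above) auto
    also have "\<dots> \<le> card A * c"
      using assms by (intro mult_right_mono of_nat_mono card_mono) auto
    finally show ?thesis .
  qed
  ultimately show ?thesis unfolding X_def by linarith
qed

lemma card_Int_insert_square:
  assumes "finite V" "finite E" "sym E" "v \<notin> V" "(v, v) \<notin> E"
  shows "card (E \<inter> insert v V \<times> insert v V) = card (E \<inter> V \<times> V) + 2 * card (E `` {v} \<inter> V)"
proof -
  have "E \<inter> insert v V \<times> insert v V = E \<inter> V \<times> V \<union> (E \<inter> {v} \<times> V \<union> E \<inter> V \<times> {v})"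
    using assms(5) by auto
  also have "card \<dots> = card (E \<inter> V \<times> V) + (card (E \<inter> {v} \<times> V) + card (E \<inter> V \<times> {v}))"
    using assms by (subst card_Un_disjoint; auto)+
  also have "card (E \<inter> V \<times> {v}) = card (E \<inter> {v} \<times> V)" by (rule card_Int_Times_sym[OF assms(3)])
  also have "card (E \<inter> {v} \<times> V) = card (E `` {v} \<inter> V)"
    using card_Int_Times[of "{v}" E V] assms(2) by simp
  finally show ?thesis by simp
qed

lemma ex_level_card_le_double:
  fixes f :: "'y \<Rightarrow> nat"
  assumes "finite Y" and "(K + 1) * card Y < (\<Sum>y\<in>Y. f y)"
  shows "\<exists>t\<ge>K. {y\<in>Y. t < f y} \<noteq> {} \<and> card {y\<in>Y. t \<le> f y} \<le> 2 * card {y\<in>Y. t < f y}"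
proof (rule ccontr)
  assume no_level: "\<not> ?thesis"
  define a where "a t = card {y\<in>Y. K + t \<le> f y}" for t
  have a_Suc: "a (Suc t) = card {y\<in>Y. K + t < f y}" for t
    by (simp add: a_def Suc_le_eq)
  have halving: "2 * a (Suc t) \<le> a t" for t
  proof (cases "{y\<in>Y. K + t < f y} = {}")
    case True
    then show ?thesis unfolding a_Suc by (simp only: card.empty)
  next
    case False
    with no_level have "\<not> card {y\<in>Y. K + t \<le> f y} \<le> 2 * card {y\<in>Y. K + t < f y}"
      using le_add1 by blast
    then show ?thesis unfolding a_Suc unfolding a_def by simp
  qed
  have geometric: "(\<Sum>t<n. a (Suc t)) + a n \<le> a 0" for n
  proof (induction n)
    case (Suc n)
    then show ?case using halving[of n] by simp
  qed simp
  define m where "m = (\<Sum>y\<in>Y. f y)"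
  have "{t \<in> {..<m}. K + t < f y} = {..<f y - K}" if "y \<in> Y" for y
    using member_le_sum[OF that, of f] assms(1) unfolding m_def by force
  then have "(\<Sum>t<m. card {y\<in>Y. K + t < f y}) = (\<Sum>y\<in>Y. f y - K)"
    using assms(1) by (intro sum_multicount_gen) auto
  then have "(\<Sum>y\<in>Y. f y - K) \<le> a 0" using geometric[of m] unfolding a_Suc by linarith
  also have "a 0 \<le> card Y" unfolding a_def using assms(1) by (intro card_mono) auto
  finally have "(\<Sum>y\<in>Y. f y - K) \<le> card Y" .
  moreover have "(\<Sum>y\<in>Y. f y) \<le> (\<Sum>y\<in>Y. (f y - K) + K)" by (intro sum_mono) simp
  ultimately show False using assms(2) by (simp add: sum.distrib mult.commute)
qed

lemma ex_independent_subset: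
  fixes R :: "('a \<times> 'a) set" and m :: real
  assumes "finite A" "sym R" "irrefl R" "0 \<le> m" "\<And>a. a \<in> A \<Longrightarrow> card (R `` {a} \<inter> A) \<le> m"
    and "L * (m + 1) \<le> card A"
  shows "\<exists>Z\<subseteq>A. card Z = L \<and> R \<inter> Z \<times> Z = {}"
  using assms(1,5,6)
proof (induction L arbitrary: A)
  case 0
  then show ?case by (intro exI[of _ "{}"]) auto
next
  case (Suc L)
  have "0 < (Suc L) * (m + 1)" using assms(4) by simp
  then obtain a where a: "a \<in> A" using Suc.prems(3) by fastforce
  define N where "N = insert a (R `` {a} \<inter> A)"
  have "N \<subseteq> A" unfolding N_def using a by auto
  have "card N \<le> card (R `` {a} \<inter> A) + 1"
    unfolding N_def using Suc.prems(1) by (simp add: card_insert_if)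
  then have "card N \<le> m + 1" using Suc.prems(2)[OF a] by linarith
  moreover have "card (A - N) = card A - card N" "card N \<le> card A"
    using \<open>N \<subseteq> A\<close> Suc.prems(1) by (meson card_Diff_subset card_mono finite_subset)+
  ultimately have "L * (m + 1) \<le> card (A - N)"
    using Suc.prems(3) by (simp add: algebra_simps of_nat_diff)
  moreover have "card (R `` {x} \<inter> (A - N)) \<le> m" if "x \<in> A - N" for x
  proof -
    have "card (R `` {x} \<inter> (A - N)) \<le> card (R `` {x} \<inter> A)"
      using Suc.prems(1) by (intro card_mono) auto
    then show ?thesis using Suc.prems(2)[of x] that by force
  qed
  ultimately obtain Z where Z: "Z \<subseteq> A - N" "card Z = L" "R \<inter> Z \<times> Z = {}"
    using Suc.IH[of "A - N"] Suc.prems(1) by blast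
  have "finite Z" using Z(1) Suc.prems(1) by (meson finite_Diff finite_subset)
  moreover have "a \<notin> Z" using Z(1) unfolding N_def by blast
  ultimately have "card (insert a Z) = Suc L" using Z(2) by simp
  moreover have "R \<inter> insert a Z \<times> insert a Z = {}"
    using Z assms(2,3) unfolding N_def by (auto dest: symD irreflD)
  ultimately show ?case using Z(1) a by (intro exI[of _ "insert a Z"]) auto
qed

section \<open>Balanced list colourings\<close>

definition list_coloring ::
    "('x \<times> 'y) set \<Rightarrow> ('x \<times> 'x) set \<Rightarrow> 'x set \<Rightarrow> ('x \<Rightarrow> 'y) \<Rightarrow> bool" where
  "list_coloring F R X f \<longleftrightarrow>
     (\<forall>x\<in>X. (x, f x) \<in> F) \<and> (\<forall>x\<in>X. \<forall>x'\<in>X. (x, x') \<in> R \<longrightarrow> f x \<noteq> f x')"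

definition color_class :: "('x \<Rightarrow> 'y) \<Rightarrow> 'x set \<Rightarrow> 'y \<Rightarrow> 'x set" where
  "color_class f X y = {x \<in> X. f x = y}"

lemma list_coloring_upd:
  assumes "list_coloring F R X f" "sym R" "irrefl R"
    and "(x, y) \<in> F" "y \<notin> f ` (R `` {x} \<inter> X)"
  shows "list_coloring F R (insert x X) (f(x := y))"
  using assms unfolding list_coloring_def by (auto dest: symD irreflD)

lemma ex_list_coloring:
  assumes "finite X" "sym R" "irrefl R"
    and "\<And>x. x \<in> X \<Longrightarrow> card (R `` {x} \<inter> X) < card (F `` {x})"
  shows "\<exists>f. list_coloring F R X f"
  using assms(1,4)
proof (induction X rule: finite_induct)
  case empty
  then show ?case by (simp add: list_coloring_def)
next
  case (insert z X)
  have fewer: "card (R `` {x} \<inter> X) < card (F `` {x})" if "x \<in> insert z X" for x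
  proof -
    have "card (R `` {x} \<inter> X) \<le> card (R `` {x} \<inter> insert z X)"
      using insert.hyps by (intro card_mono) auto
    then show ?thesis using insert.prems[OF that] by simp
  qed
  then obtain f where f: "list_coloring F R X f" using insert.IH by blast
  have "card (f ` (R `` {z} \<inter> X)) \<le> card (R `` {z} \<inter> X)"
    using insert.hyps by (intro card_image_le) auto
  also have "\<dots> < card (F `` {z})" using fewer by simp
  finally have "\<not> F `` {z} \<subseteq> f ` (R `` {z} \<inter> X)"
    using card_mono[of "f ` (R `` {z} \<inter> X)" "F `` {z}"] insert.hyps(1) by auto
  then obtain y where "(z, y) \<in> F" "y \<notin> f ` (R `` {z} \<inter> X)" by auto
  then show ?case using list_coloring_upd[OF f assms(2,3)] by blast
qed

lemma sum_power2_card_color_class_upd: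
  assumes "finite X" "finite Y" "x \<in> X" "f x \<in> Y" "z \<in> Y" "z \<noteq> f x"
  shows "(\<Sum>y\<in>Y. (card (color_class (f(x := z)) X y))\<^sup>2) + 2 * card (color_class f X (f x))
    = (\<Sum>y\<in>Y. (card (color_class f X y))\<^sup>2) + 2 * card (color_class f X z) + 2"
proof -
  let ?load = "\<lambda>h y. card (color_class h X y)"
  let ?g = "f(x := z)"
  have "color_class f X (f x) = insert x (color_class ?g X (f x))"
    "color_class ?g X z = insert x (color_class f X z)"
    using assms by (auto simp: color_class_def)
  then have changed: "?load f (f x) = ?load ?g (f x) + 1" "?load ?g z = ?load f z + 1"
    using assms by (auto simp: color_class_def)
  have "color_class ?g X y = color_class f X y" if "y \<noteq> z" "y \<noteq> f x" for y
    using that by (auto simp: color_class_def)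
  then have unchanged: "(\<Sum>y\<in>Y - {f x} - {z}. (?load ?g y)\<^sup>2) = (\<Sum>y\<in>Y - {f x} - {z}. (?load f y)\<^sup>2)"
    by (intro sum.cong) auto
  have "(\<Sum>y\<in>Y. (?load h y)\<^sup>2)
      = (?load h (f x))\<^sup>2 + ((?load h z)\<^sup>2 + (\<Sum>y\<in>Y - {f x} - {z}. (?load h y)\<^sup>2))" for h
    using assms by (subst sum.remove[of Y "f x"]; simp?) (subst sum.remove[of "Y - {f x}" z]; simp)
  then show ?thesis using unchanged changed by (simp add: power2_eq_square algebra_simps)
qed

lemma ex_balanced_list_coloring:
  assumes "finite X" "finite Y" "F `` X \<subseteq> Y" "sym R" "irrefl R" and ex: "\<exists>f. list_coloring F R X f"
  shows "\<exists>f. list_coloring F R X f \<and> (\<forall>x\<in>X. \<forall>z \<in> F `` {x} - f ` (R `` {x} \<inter> X).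
    card (color_class f X (f x)) \<le> card (color_class f X z) + 1)"
proof -
  \<comment> \<open>A colouring that minimises the sum of the squared class sizes is balanced.\<close>
  define potential where "potential f = (\<Sum>y\<in>Y. (card (color_class f X y))\<^sup>2)" for f
  obtain f where f: "list_coloring F R X f"
    and least: "\<And>g. list_coloring F R X g \<Longrightarrow> potential f \<le> potential g"
    using ex_has_least_nat[of "list_coloring F R X" _ potential] ex by auto
  have "card (color_class f X (f x)) \<le> card (color_class f X z) + 1"
    if x: "x \<in> X" and z: "z \<in> F `` {x} - f ` (R `` {x} \<inter> X)" for x z
  proof (cases "z = f x")
    case False
    have "f x \<in> Y" "z \<in> Y" using f x z assms(3) unfolding list_coloring_def by auto
    have "list_coloring F R (insert x X) (f(x := z))"
      using z by (intro list_coloring_upd f assms(4,5)) auto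
    then have "potential f \<le> potential (f(x := z))"
      using x by (intro least) (simp add: insert_absorb)
    then show ?thesis
      using sum_power2_card_color_class_upd[of X Y x f z] assms(1,2) x \<open>f x \<in> Y\<close> \<open>z \<in> Y\<close> False
      unfolding potential_def by linarith
  qed simp
  with f show ?thesis by blast
qed

lemma ex_popular_colors:
  fixes F :: "('x \<times> 'y) set" and d \<mu> :: real
  assumes "finite X" "finite Y" "F `` X \<subseteq> Y" "sym R" "irrefl R"
    and few_conflicts: "\<And>x. x \<in> X \<Longrightarrow> card (R `` {x} \<inter> X) \<le> \<mu>"
    and many_colors: "\<And>x. x \<in> X \<Longrightarrow> d \<le> card (F `` {x})" and "\<mu> < d"
    and "(K + 1) * card Y < card X"
  obtains f S T where "list_coloring F R X f" "S \<noteq> {}" "S \<subseteq> T" "T \<subseteq> Y" "card T \<le> 2 * card S"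
    and "\<And>y. y \<in> S \<Longrightarrow> K \<le> card (color_class f X y)"
    and "\<And>x. \<lbrakk>x \<in> X; f x \<in> S\<rbrakk> \<Longrightarrow> d - \<mu> \<le> card (F `` {x} \<inter> T)"
proof -
  have "card (R `` {x} \<inter> X) < card (F `` {x})" if "x \<in> X" for x
    using few_conflicts[OF that] many_colors[OF that] \<open>\<mu> < d\<close> by linarith
  then have "\<exists>f. list_coloring F R X f" using assms(1,4,5) by (intro ex_list_coloring)
  from ex_balanced_list_coloring[OF assms(1-5) this]
  obtain f where f: "list_coloring F R X f"
    and balanced: "\<And>x z. \<lbrakk>x \<in> X; z \<in> F `` {x} - f ` (R `` {x} \<inter> X)\<rbrakk> \<Longrightarrow>
      card (color_class f X (f x)) \<le> card (color_class f X z) + 1"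
    by blast
  have "f ` X \<subseteq> Y" using f assms(3) unfolding list_coloring_def by blast
  then have "(\<Sum>y\<in>Y. card (color_class f X y)) = card X"
    using sum.group[OF assms(1,2), of f "\<lambda>_. 1 :: nat"] unfolding color_class_def by simp
  then obtain t where t: "t \<ge> K" "{y\<in>Y. t < card (color_class f X y)} \<noteq> {}"
    "card {y\<in>Y. t \<le> card (color_class f X y)} \<le> 2 * card {y\<in>Y. t < card (color_class f X y)}"
    using ex_level_card_le_double[OF assms(2), of K "\<lambda>y. card (color_class f X y)"] assms(9) by auto
  define S where "S = {y\<in>Y. t < card (color_class f X y)}"
  define T where "T = {y\<in>Y. t \<le> card (color_class f X y)}"
  have "d - \<mu> \<le> card (F `` {x} \<inter> T)" if x: "x \<in> X" "f x \<in> S" for x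
  proof -
    have "F `` {x} \<subseteq> (F `` {x} \<inter> T) \<union> f ` (R `` {x} \<inter> X)"
      using balanced[OF x(1)] x assms(3) unfolding S_def T_def by fastforce
    moreover have "finite (F `` {x} \<inter> T)" unfolding T_def using assms(2) by simp
    ultimately have "card (F `` {x}) \<le> card ((F `` {x} \<inter> T) \<union> f ` (R `` {x} \<inter> X))"
      using assms(1) by (intro card_mono) auto
    also have "\<dots> \<le> card (F `` {x} \<inter> T) + card (f ` (R `` {x} \<inter> X))" by (rule card_Un_le)
    also have "\<dots> \<le> card (F `` {x} \<inter> T) + card (R `` {x} \<inter> X)"
      using assms(1) by (simp add: card_image_le)
    finally show ?thesis using few_conflicts[OF x(1)] many_colors[OF x(1)] by linarith
  qed
  moreover have "S \<noteq> {}" "S \<subseteq> T" "T \<subseteq> Y" "card T \<le> 2 * card S"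
    "\<And>y. y \<in> S \<Longrightarrow> K \<le> card (color_class f X y)"
    using t unfolding S_def T_def by auto
  ultimately show thesis using that f by blast
qed

section \<open>Locally sparse relations\<close>

text \<open>A graph is represented by its symmetric edge relation \<open>E\<close>, so \<open>card E\<close> counts every edge twice.\<close>

definition sparse_upto :: "('v \<times> 'v) set \<Rightarrow> real \<Rightarrow> real \<Rightarrow> bool" where
  "sparse_upto E N \<delta> \<longleftrightarrow>
     (\<forall>S. finite S \<and> real (card S) \<le> N \<longrightarrow> real (card (E \<inter> S \<times> S)) \<le> \<delta> * real (card S))"

definition sparse_within :: "('v \<times> 'v) set \<Rightarrow> 'v set \<Rightarrow> real \<Rightarrow> bool" where
  "sparse_within E V \<rho> \<longleftrightarrow> (\<forall>S\<subseteq>V. real (card (E \<inter> S \<times> S)) \<le> \<rho> * real (card S))"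

definition overlap_rel :: "('x \<times> 'y) set \<Rightarrow> real \<Rightarrow> ('x \<times> 'x) set" where
  "overlap_rel F \<eta> = {(x, x'). x \<noteq> x' \<and> \<eta> < real (card (F `` {x} \<inter> F `` {x'}))}"

definition cluster_rel :: "('v \<times> 'v) set \<Rightarrow> ('w \<Rightarrow> 'v set) \<Rightarrow> 'w set \<Rightarrow> ('v \<times> 'w) set" where
  "cluster_rel E C Y = {(x, y). y \<in> Y \<and> (\<exists>c\<in>C y. (x, c) \<in> E)}"

lemma sparse_upto_mono:
  fixes E :: "('v \<times> 'v) set"
  assumes "sparse_upto E N \<delta>" "E' \<subseteq> E" "finite E"
  shows "sparse_upto E' N \<delta>"
  unfolding sparse_upto_def
proof (intro allI impI)
  fix S :: "'v set" assume S: "finite S \<and> card S \<le> N"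
  have "card (E' \<inter> S \<times> S) \<le> card (E \<inter> S \<times> S)"
    using assms by (intro card_mono) auto
  also have "\<dots> \<le> \<delta> * card S" using assms(1) S unfolding sparse_upto_def by blast
  finally show "card (E' \<inter> S \<times> S) \<le> \<delta> * card S" by simp
qed

lemma sym_overlap_rel: "sym (overlap_rel F \<eta>)"
  unfolding overlap_rel_def sym_def by (auto simp: Int_commute)

lemma irrefl_overlap_rel: "irrefl (overlap_rel F \<eta>)"
  unfolding overlap_rel_def irrefl_def by simp

lemma card_Image_ge_if_independent:
  fixes F :: "('x \<times> 'y) set" and a \<eta> :: real
  assumes "finite Z" "\<And>x. x \<in> Z \<Longrightarrow> finite (F `` {x})" "overlap_rel F \<eta> \<inter> Z \<times> Z = {}" "0 \<le> \<eta>"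
    and "\<And>x. x \<in> Z \<Longrightarrow> a \<le> card (F `` {x} \<inter> T)"
  shows "card Z * a - (card Z)\<^sup>2 * \<eta> \<le> card (F `` Z \<inter> T)"
proof -
  have overlap: "card ((F `` {x} \<inter> T) \<inter> (F `` {y} \<inter> T)) \<le> \<eta>" if "x \<in> Z" "y \<in> Z" "x \<noteq> y" for x y
  proof -
    have "card ((F `` {x} \<inter> T) \<inter> (F `` {y} \<inter> T)) \<le> card (F `` {x} \<inter> F `` {y})"
      using assms(2) that by (intro card_mono) auto
    moreover have "(x, y) \<notin> overlap_rel F \<eta>" using assms(3) that(1,2) by blast
    ultimately show ?thesis using that(3) unfolding overlap_rel_def by simp
  qed
  have "card Z * a \<le> (\<Sum>x\<in>Z. real (card (F `` {x} \<inter> T)))"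
    by (rule sum_bounded_below) (rule assms(5))
  moreover have "(\<Sum>x\<in>Z. real (card (F `` {x} \<inter> T))) - (card Z)\<^sup>2 * \<eta> \<le> card (\<Union>x\<in>Z. F `` {x} \<inter> T)"
    using assms overlap by (intro card_UN_Bonferroni) auto
  moreover have "(\<Union>x\<in>Z. F `` {x} \<inter> T) = F `` Z \<inter> T" by auto
  ultimately show ?thesis by simp
qed

lemma finite_cluster_rel: "finite E \<Longrightarrow> finite Y \<Longrightarrow> finite (cluster_rel E C Y)"
  by (rule finite_subset[of _ "Domain E \<times> Y"]) (auto simp: cluster_rel_def finite_Domain)

lemma card_cluster_rel_le:
  assumes "finite E" "disjoint_family_on C Y"
  shows "card (cluster_rel E C Y \<inter> S \<times> UNIV) \<le> card (E \<inter> S \<times> (\<Union>y\<in>Y. C y))"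
proof (rule card_le_if_inj_on_rel[where r = "\<lambda>(x, y) (x', c). x = x' \<and> c \<in> C y"])
  fix p q e
  assume "p \<in> cluster_rel E C Y \<inter> S \<times> UNIV" "q \<in> cluster_rel E C Y \<inter> S \<times> UNIV"
    and "(case p of (x, y) \<Rightarrow> \<lambda>(x', c). x = x' \<and> c \<in> C y) e"
    and "(case q of (x, y) \<Rightarrow> \<lambda>(x', c). x = x' \<and> c \<in> C y) e"
  then show "p = q"
    using assms(2) unfolding cluster_rel_def disjoint_family_on_def by (cases e) auto
qed (use assms(1) in \<open>auto simp: cluster_rel_def\<close>)

lemma card_cluster_rel_Image_le:
  assumes "finite E" "disjoint_family_on C Y"
  shows "card (cluster_rel E C Y `` {x}) \<le> card (E `` {x})"
proof -
  have "cluster_rel E C Y \<inter> {x} \<times> UNIV = {x} \<times> cluster_rel E C Y `` {x}" by auto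
  then have "card (cluster_rel E C Y `` {x}) \<le> card (E \<inter> {x} \<times> (\<Union>y\<in>Y. C y))"
    using card_cluster_rel_le[OF assms, of "{x}"] by (simp add: card_cartesian_product)
  also have "\<dots> \<le> card ({x} \<times> E `` {x})"
    using assms(1) by (intro card_mono) (auto simp: finite_Image)
  finally show ?thesis by (simp add: card_cartesian_product)
qed

lemma card_mult_le_card_edges_to_clusters:
  fixes \<eta> :: real
  assumes "finite E" "finite T" "finite Y" "disjoint_family_on C Y"
    and "\<And>x. x \<in> T \<Longrightarrow> \<eta> \<le> card (cluster_rel E C Y `` {x})"
  shows "card T * \<eta> \<le> card (E \<inter> T \<times> (\<Union>y\<in>Y. C y))"
proof -
  have "card T * \<eta> \<le> (\<Sum>x\<in>T. real (card (cluster_rel E C Y `` {x})))"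
    by (rule sum_bounded_below) (rule assms(5))
  also have "\<dots> = card (cluster_rel E C Y \<inter> T \<times> UNIV)"
    using card_Int_Times[OF assms(2) finite_cluster_rel[OF assms(1,3)], of C UNIV] by simp
  also have "\<dots> \<le> card (E \<inter> T \<times> (\<Union>y\<in>Y. C y))"
    by (intro of_nat_mono card_cluster_rel_le assms(1,4))
  finally show ?thesis .
qed

lemma card_mult_le_if_overlapping:
  fixes E :: "('v \<times> 'v) set" and C :: "'w \<Rightarrow> 'v set" and Y :: "'w set" and \<delta> \<eta> N s :: real
  defines "F \<equiv> cluster_rel E C Y"
  assumes "finite E" and sparse: "sparse_upto E N \<delta>" and "finite Y"
    and "disjoint_family_on C Y" "\<And>y. y \<in> Y \<Longrightarrow> finite (C y)"
    and small: "card (\<Union>y \<in> F `` {x}. C y) \<le> s"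
    and T: "finite T" "T \<subseteq> overlap_rel F \<eta> `` {x}" "card T + s \<le> N" and "0 \<le> \<delta>"
  shows "card T * \<eta> \<le> \<delta> * (card T + s)"
proof -
  define U where "U = (\<Union>y \<in> F `` {x}. C y)"
  have "F `` {x} \<subseteq> Y" unfolding F_def cluster_rel_def by auto
  have "finite (F `` {x})" using \<open>F `` {x} \<subseteq> Y\<close> \<open>finite Y\<close> by (rule finite_subset)
  have "finite U"
    unfolding U_def using \<open>F `` {x} \<subseteq> Y\<close> \<open>finite (F `` {x})\<close> assms(6) by blast
  have card_TU: "card (T \<union> U) \<le> card T + s"
    using card_Un_le[of T U] small unfolding U_def by linarith
  have "card T * \<eta> \<le> card (E \<inter> T \<times> U)"
    unfolding U_def
  proof (rule card_mult_le_card_edges_to_clusters[OF assms(2) T(1) \<open>finite (F `` {x})\<close>])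
    show "disjoint_family_on C (F `` {x})"
      using \<open>F `` {x} \<subseteq> Y\<close> assms(5) by (rule disjoint_family_on_mono)
    fix x' assume "x' \<in> T"
    then have "\<eta> < card (F `` {x} \<inter> F `` {x'})" using T(2) unfolding overlap_rel_def by auto
    also have "F `` {x} \<inter> F `` {x'} = cluster_rel E C (F `` {x}) `` {x'}"
      unfolding F_def cluster_rel_def by auto
    finally show "\<eta> \<le> card (cluster_rel E C (F `` {x}) `` {x'})" by simp
  qed
  also have "\<dots> \<le> card (E \<inter> (T \<union> U) \<times> (T \<union> U))"
    using assms(2) by (intro of_nat_mono card_mono) auto
  also have "\<dots> \<le> \<delta> * card (T \<union> U)"
    using sparse T(1,3) \<open>finite U\<close> card_TU unfolding sparse_upto_def by fastforce
  also have "\<dots> \<le> \<delta> * (card T + s)" using card_TU \<open>0 \<le> \<delta>\<close> by (rule mult_left_mono)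
  finally show ?thesis .
qed

text \<open>Many vertices sharing a fixed positive proportion of the neighbourhood of \<open>x\<close> would span,
  together with that neighbourhood, a small set that is too dense.\<close>

lemma card_overlap_rel_Image_le:
  fixes E :: "('v \<times> 'v) set" and C :: "'w \<Rightarrow> 'v set" and Y :: "'w set" and \<delta> \<eta> N s :: real
  defines "F \<equiv> cluster_rel E C Y"
  assumes "finite E" "sparse_upto E N \<delta>" "finite X" "finite Y"
    and "disjoint_family_on C Y" "\<And>y. y \<in> Y \<Longrightarrow> finite (C y)"
    and "card (\<Union>y \<in> F `` {x}. C y) \<le> s" and "1 \<le> s" "3 * s \<le> N"
    and "0 < \<delta>" "2 * \<delta> \<le> \<eta>"
  shows "card (overlap_rel F \<eta> `` {x} \<inter> X) \<le> 2 * \<delta> * s / \<eta>"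
proof (rule ccontr)
  define m where "m = 2 * \<delta> * s / \<eta>"
  define k where "k = nat \<lfloor>m\<rfloor> + 1"
  assume "\<not> ?thesis"
  then have many: "m < card (overlap_rel F \<eta> `` {x} \<inter> X)" unfolding m_def by simp
  have "0 < \<eta>" "0 \<le> m" using assms(9-12) unfolding m_def by auto
  have "m \<le> s"
    using mult_right_mono[OF \<open>2 * \<delta> \<le> \<eta>\<close>, of s] \<open>0 < \<eta>\<close> \<open>1 \<le> s\<close>
    unfolding m_def by (simp add: divide_le_eq mult.commute)
  have k: "m < k" "k \<le> m + 1" using \<open>0 \<le> m\<close> unfolding k_def by linarith+
  have "k \<le> card (overlap_rel F \<eta> `` {x} \<inter> X)" using many \<open>0 \<le> m\<close> unfolding k_def by linarith
  then obtain T where T: "T \<subseteq> overlap_rel F \<eta> `` {x} \<inter> X" "card T = k"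
    by (meson obtain_subset_with_card_n)
  have "card T * \<eta> \<le> \<delta> * (card T + s)"
    unfolding F_def
  proof (rule card_mult_le_if_overlapping[OF assms(2,3,5-8)[unfolded F_def]])
    show "finite T" using T(1) \<open>finite X\<close> by (meson finite_Int finite_subset)
    show "T \<subseteq> overlap_rel (cluster_rel E C Y) \<eta> `` {x}" using T(1) unfolding F_def by blast
    show "card T + s \<le> N" using k T(2) \<open>m \<le> s\<close> \<open>1 \<le> s\<close> \<open>3 * s \<le> N\<close> by linarith
    show "0 \<le> \<delta>" using \<open>0 < \<delta>\<close> by simp
  qed
  then have "k * \<eta> \<le> \<delta> * (k + s)" using T(2) by simp
  moreover have "k * (2 * \<delta>) \<le> k * \<eta>" using \<open>2 * \<delta> \<le> \<eta>\<close> by (intro mult_left_mono) auto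
  ultimately have "k * \<eta> \<le> 2 * \<delta> * s" by (simp add: algebra_simps)
  then have "k \<le> m" unfolding m_def using \<open>0 < \<eta>\<close> by (simp add: le_divide_eq)
  then show False using k by simp
qed

lemma card_Image_minus_singleton_ge:
  fixes F :: "('x \<times> 'y) set" and d :: real and K :: nat
  assumes "card Z = K" "1 \<le> K" "4 \<le> d" "\<And>x. x \<in> Z \<Longrightarrow> finite (F `` {x})"
    and "overlap_rel F (d / (4 * K)) \<inter> Z \<times> Z = {}"
    and "\<And>x. x \<in> Z \<Longrightarrow> 3 / 4 * d \<le> card (F `` {x} \<inter> T)"
  shows "K * d / 4 \<le> card (F `` Z \<inter> T - {y})"
proof -
  have "finite Z" using assms(1,2) by (simp add: card_ge_0_finite)
  have "card Z * (3 / 4 * d) - (card Z)\<^sup>2 * (d / (4 * K)) \<le> card (F `` Z \<inter> T)"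
    using assms(3-6) \<open>finite Z\<close> by (intro card_Image_ge_if_independent) auto
  then have "K * d / 2 \<le> card (F `` Z \<inter> T)"
    using assms(1,2) by (simp add: power2_eq_square field_simps)
  moreover have "card (F `` Z \<inter> T) \<le> card (F `` Z \<inter> T - {y}) + 1"
    using diff_card_le_card_Diff[of "{y}" "F `` Z \<inter> T"] by simp
  moreover have "1 \<le> K * d / 4" using assms(2,3) mult_mono[of 1 "real K" 4 d] by simp
  ultimately show ?thesis by linarith
qed

lemma ex_expanding_stars:
  fixes F :: "('x \<times> 'y) set" and d :: real and K :: nat
  assumes "finite X" "finite Y" "F `` X \<subseteq> Y"
    and degree: "\<And>x. x \<in> X \<Longrightarrow> d \<le> card (F `` {x})" and "4 \<le> d" "1 \<le> K"
    and overlaps: "\<And>x. x \<in> X \<Longrightarrow> card (overlap_rel F (d / (4 * K)) `` {x} \<inter> X) \<le> d / 4"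
    and "(K + 1) * card Y < card X"
  obtains S T Z where "S \<noteq> {}" "S \<subseteq> T" "T \<subseteq> Y" "card T \<le> 2 * card S"
    and "disjoint_family_on Z S" "\<And>y. y \<in> S \<Longrightarrow> Z y \<subseteq> X" "\<And>y. y \<in> S \<Longrightarrow> card (Z y) = K"
    and "\<And>y z. \<lbrakk>y \<in> S; z \<in> Z y\<rbrakk> \<Longrightarrow> (z, y) \<in> F"
    and "\<And>y. y \<in> S \<Longrightarrow> K * d / 4 \<le> card (F `` Z y \<inter> T - {y})"
proof -
  define R where "R = overlap_rel F (d / (4 * K))"
  have R: "sym R" "irrefl R" unfolding R_def by (rule sym_overlap_rel irrefl_overlap_rel)+
  have "d / 4 < d" using \<open>4 \<le> d\<close> by simp
  with ex_popular_colors[OF assms(1-3) R overlaps[folded R_def] degree _ assms(8)]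
  obtain f S T where f: "list_coloring F R X f"
    and ST: "S \<noteq> {}" "S \<subseteq> T" "T \<subseteq> Y" "card T \<le> 2 * card S"
    and popular: "\<And>y. y \<in> S \<Longrightarrow> K \<le> card (color_class f X y)"
    and near: "\<And>x. \<lbrakk>x \<in> X; f x \<in> S\<rbrakk> \<Longrightarrow> d - d / 4 \<le> card (F `` {x} \<inter> T)"
    by blast
  have "\<exists>Z. Z \<subseteq> color_class f X y \<and> card Z = K" if "y \<in> S" for y
    using popular[OF that] by (meson obtain_subset_with_card_n)
  then obtain Z where Z: "\<And>y. y \<in> S \<Longrightarrow> Z y \<subseteq> color_class f X y" "\<And>y. y \<in> S \<Longrightarrow> card (Z y) = K"
    by metis
  have colored: "x \<in> X \<and> f x = y" if "y \<in> S" "x \<in> Z y" for x y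
    using Z(1) that unfolding color_class_def by blast
  have expanding: "K * d / 4 \<le> card (F `` Z y \<inter> T - {y})" if y: "y \<in> S" for y
  proof (rule card_Image_minus_singleton_ge[OF Z(2)[OF y] \<open>1 \<le> K\<close> \<open>4 \<le> d\<close>])
    show "finite (F `` {x})" if "x \<in> Z y" for x
      using degree[of x] colored[OF y that] \<open>4 \<le> d\<close> by (intro card_ge_0_finite) linarith
    show "overlap_rel F (d / (4 * K)) \<inter> Z y \<times> Z y = {}"
      using f colored[OF y] unfolding list_coloring_def R_def by fastforce
    show "3 / 4 * d \<le> card (F `` {x} \<inter> T)" if "x \<in> Z y" for x
      using near[of x] colored[OF y that] y by simp
  qed
  have "disjoint_family_on Z S"
    unfolding disjoint_family_on_def using colored by blast
  moreover have "Z y \<subseteq> X" "\<And>z. z \<in> Z y \<Longrightarrow> (z, y) \<in> F" if "y \<in> S" for y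
    using colored[OF that] f unfolding list_coloring_def by blast+
  ultimately show thesis using that ST Z(2) expanding by blast
qed

section \<open>Contractions\<close>

definition connected_rel :: "('v \<times> 'v) set \<Rightarrow> 'v set \<Rightarrow> bool" where
  "connected_rel E S \<longleftrightarrow> S \<noteq> {} \<and> S \<times> S \<subseteq> (E \<inter> S \<times> S)\<^sup>*"

definition quotient_rel :: "('v \<times> 'v) set \<Rightarrow> ('w \<Rightarrow> 'v set) \<Rightarrow> 'w set \<Rightarrow> ('w \<times> 'w) set" where
  "quotient_rel E C V =
     {(x, y). x \<in> V \<and> y \<in> V \<and> x \<noteq> y \<and> (\<exists>u\<in>C x. \<exists>v\<in>C y. (u, v) \<in> E)}"

locale clustering =
  fixes E :: "('v \<times> 'v) set" and W :: "'v set" and C :: "'w \<Rightarrow> 'v set"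
    and V :: "'w set" and g :: real
  assumes finite_index: "finite V"
    and index_nonempty: "V \<noteq> {}"
    and disjoint_clusters: "disjoint_family_on C V"
    and cluster_subset: "x \<in> V \<Longrightarrow> C x \<subseteq> W"
    and finite_cluster: "x \<in> V \<Longrightarrow> finite (C x)"
    and card_cluster_le: "x \<in> V \<Longrightarrow> card (C x) \<le> g"
    and connected_cluster: "x \<in> V \<Longrightarrow> connected_rel E (C x)"

definition dense_contraction :: "('v \<times> 'v) set \<Rightarrow> 'v set \<Rightarrow> real \<Rightarrow> real \<Rightarrow> bool" where
  "dense_contraction E W g D \<longleftrightarrow>
     (\<exists>C (V :: 'v set). clustering E W C V g \<and> D * card V \<le> card (quotient_rel E C V))"

lemma connected_rel_singleton: "connected_rel E {x}"
  by (simp add: connected_rel_def)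

lemma connected_rel_mono:
  assumes "connected_rel E S" "E \<subseteq> E'"
  shows "connected_rel E' S"
proof -
  have "(E \<inter> S \<times> S)\<^sup>* \<subseteq> (E' \<inter> S \<times> S)\<^sup>*" using assms(2) by (intro rtrancl_mono) auto
  then show ?thesis using assms(1) unfolding connected_rel_def by blast
qed

lemma connected_rel_Un_leaves:
  assumes "connected_rel E S" "sym E" and leaf: "\<And>z. z \<in> Z \<Longrightarrow> \<exists>c\<in>S. (z, c) \<in> E"
  shows "connected_rel E (S \<union> Z)"
proof -
  let ?R = "E \<inter> (S \<union> Z) \<times> (S \<union> Z)"
  have "(E \<inter> S \<times> S)\<^sup>* \<subseteq> ?R\<^sup>*" by (intro rtrancl_mono) auto
  then have core: "S \<times> S \<subseteq> ?R\<^sup>*" using assms(1) unfolding connected_rel_def by blast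
  have link: "\<exists>c\<in>S. (u, c) \<in> ?R\<^sup>* \<and> (c, u) \<in> ?R\<^sup>*" if u: "u \<in> S \<union> Z" for u
  proof (cases "u \<in> S")
    case False
    then obtain c where c: "c \<in> S" "(u, c) \<in> E" using u leaf by blast
    then have "(u, c) \<in> ?R" "(c, u) \<in> ?R" using u assms(2) by (auto dest: symD)
    then show ?thesis using c by blast
  qed auto
  have "(u, v) \<in> ?R\<^sup>*" if "u \<in> S \<union> Z" "v \<in> S \<union> Z" for u v
    using link[OF that(1)] link[OF that(2)] core by (meson SigmaI rtrancl_trans subsetD)
  then show ?thesis using assms(1) unfolding connected_rel_def by blast
qed

lemma connected_rel_UN:
  assumes "connected_rel (quotient_rel E B V) I" and clusters: "\<And>c. c \<in> I \<Longrightarrow> connected_rel E (B c)"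
  shows "connected_rel E (\<Union>c\<in>I. B c)"
proof -
  let ?U = "\<Union>c\<in>I. B c"
  let ?R = "E \<inter> ?U \<times> ?U"
  have within: "(u, v) \<in> ?R\<^sup>*" if "c \<in> I" "u \<in> B c" "v \<in> B c" for c u v
  proof -
    have "(E \<inter> B c \<times> B c)\<^sup>* \<subseteq> ?R\<^sup>*" using that(1) by (intro rtrancl_mono) auto
    then show ?thesis using clusters[OF that(1)] that unfolding connected_rel_def by blast
  qed
  have between: "(u, v) \<in> ?R\<^sup>*"
    if "(c, c') \<in> (quotient_rel E B V \<inter> I \<times> I)\<^sup>*" "v \<in> B c'" "c \<in> I" "u \<in> B c" for c c' u v
    using that(1,2)
  proof (induction arbitrary: v rule: rtrancl_induct)
    case base
    then show ?case using within that(3,4) by blast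
  next
    case (step c' c'')
    then obtain a b where ab: "a \<in> B c'" "b \<in> B c''" "(a, b) \<in> E" and "c' \<in> I" "c'' \<in> I"
      unfolding quotient_rel_def by blast
    have "(u, a) \<in> ?R\<^sup>*" using step.IH ab by blast
    also have "(a, b) \<in> ?R" using ab \<open>c' \<in> I\<close> \<open>c'' \<in> I\<close> by blast
    also have "(b, v) \<in> ?R\<^sup>*" using within[OF \<open>c'' \<in> I\<close>] ab step.prems by blast
    finally show ?case .
  qed
  have "?U \<noteq> {}" using assms unfolding connected_rel_def by blast
  moreover have "(u, v) \<in> ?R\<^sup>*" if "u \<in> ?U" "v \<in> ?U" for u v
    using that assms(1) between unfolding connected_rel_def by blast
  ultimately show ?thesis unfolding connected_rel_def by blast
qed

lemma finite_quotient_rel: "finite V \<Longrightarrow> finite (quotient_rel E C V)"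
  by (rule finite_subset[of _ "V \<times> V"]) (auto simp: quotient_rel_def)

lemma quotient_rel_subset: "quotient_rel E C V \<subseteq> V \<times> V"
  unfolding quotient_rel_def by auto

lemma irrefl_quotient_rel: "irrefl (quotient_rel E C V)"
  unfolding quotient_rel_def irrefl_def by auto

lemma sym_quotient_rel: "sym E \<Longrightarrow> sym (quotient_rel E C V)"
  unfolding quotient_rel_def sym_def by blast

lemma quotient_rel_mono: "E \<subseteq> E' \<Longrightarrow> quotient_rel E C V \<subseteq> quotient_rel E' C V"
  unfolding quotient_rel_def by auto

lemma quotient_rel_singletons: "irrefl E \<Longrightarrow> quotient_rel E (\<lambda>x. {x}) V = E \<inter> V \<times> V"
  unfolding quotient_rel_def irrefl_def by auto

lemma quotient_rel_quotient_rel_subset: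
  "quotient_rel (quotient_rel E B V) C V' \<subseteq> quotient_rel E (\<lambda>x. \<Union>c\<in>C x. B c) V'"
  unfolding quotient_rel_def by blast

lemma clustering_singletons:
  assumes "finite V" "V \<noteq> {}" "V \<subseteq> W" "1 \<le> g"
  shows "clustering E W (\<lambda>x. {x}) V g"
  using assms by unfold_locales (auto simp: disjoint_family_on_def connected_rel_singleton)

lemma clustering_mono:
  assumes "clustering E W C V g" "E \<subseteq> E'" "W \<subseteq> W'"
  shows "clustering E' W' C V g"
proof -
  interpret clustering E W C V g by fact
  show ?thesis
    using finite_index index_nonempty disjoint_clusters finite_cluster card_cluster_le
      cluster_subset connected_cluster assms(2,3)
    by unfold_locales (blast intro: connected_rel_mono)+
qed

lemma clustering_restrict:
  assumes "clustering E W C V g" "S \<subseteq> V" "S \<noteq> {}"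
  shows "clustering E W C S g"
proof -
  interpret clustering E W C V g by fact
  show ?thesis
  proof
    show "finite S" using assms(2) finite_index by (rule finite_subset)
    show "disjoint_family_on C S" using assms(2) disjoint_clusters by (rule disjoint_family_on_mono)
  qed (use assms(2,3) cluster_subset finite_cluster card_cluster_le connected_cluster in blast)+
qed

context clustering
begin

lemma one_le_bound: "1 \<le> g"
proof -
  obtain x where "x \<in> V" using index_nonempty by blast
  then have "0 < card (C x)"
    using finite_cluster connected_cluster unfolding connected_rel_def by (simp add: card_gt_0_iff)
  then show ?thesis using card_cluster_le[OF \<open>x \<in> V\<close>] by linarith
qed

lemma card_UN_clusters_le:
  assumes "finite I" "I \<subseteq> V"
  shows "card (\<Union>x\<in>I. C x) \<le> card I * g"
proof -
  have "real (card (\<Union>x\<in>I. C x)) \<le> (\<Sum>x\<in>I. real (card (C x)))"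
    using card_UN_le[OF assms(1), of C] by (metis of_nat_le_iff of_nat_sum)
  also have "\<dots> \<le> card I * g" using assms(2) by (intro sum_bounded_above card_cluster_le) auto
  finally show ?thesis .
qed

lemma attach_leaves:
  assumes "sym E"
    and "\<And>x. x \<in> V \<Longrightarrow> Z x \<subseteq> W" "\<And>x. x \<in> V \<Longrightarrow> finite (Z x)" "\<And>x. x \<in> V \<Longrightarrow> card (Z x) \<le> k"
    and leaf: "\<And>x z. \<lbrakk>x \<in> V; z \<in> Z x\<rbrakk> \<Longrightarrow> (z, x) \<in> cluster_rel E C V"
    and "disjoint_family_on Z V" "\<And>x y. \<lbrakk>x \<in> V; y \<in> V\<rbrakk> \<Longrightarrow> Z x \<inter> C y = {}"
  shows "clustering E W (\<lambda>x. C x \<union> Z x) V (g + k)"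
proof
  show "finite V" "V \<noteq> {}" by (rule finite_index index_nonempty)+
  show "disjoint_family_on (\<lambda>x. C x \<union> Z x) V"
    using disjoint_clusters assms(6,7) unfolding disjoint_family_on_def by blast
  fix x assume x: "x \<in> V"
  show "C x \<union> Z x \<subseteq> W" "finite (C x \<union> Z x)"
    using cluster_subset finite_cluster assms(2,3) x by auto
  show "card (C x \<union> Z x) \<le> g + k"
    using card_Un_le[of "C x" "Z x"] card_cluster_le[OF x] assms(4)[OF x] by linarith
  show "connected_rel E (C x \<union> Z x)"
    using leaf[OF x] unfolding cluster_rel_def
    by (intro connected_rel_Un_leaves connected_cluster x assms(1)) auto
qed

lemma compose:
  assumes "clustering (quotient_rel E C V) V C' V' k"
  shows "clustering E W (\<lambda>x. \<Union>c\<in>C' x. C c) V' (g * k)"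
proof -
  interpret outer: clustering "quotient_rel E C V" V C' V' k by fact
  show ?thesis
  proof
    show "finite V'" "V' \<noteq> {}" by (rule outer.finite_index outer.index_nonempty)+
    show "disjoint_family_on (\<lambda>x. \<Union>c\<in>C' x. C c) V'"
      unfolding disjoint_family_on_def
    proof (intro ballI impI)
      fix x y assume xy: "x \<in> V'" "y \<in> V'" "x \<noteq> y"
      have "C' x \<inter> C' y = {}" by (rule disjoint_family_onD[OF outer.disjoint_clusters xy])
      then have "C c \<inter> C c' = {}" if "c \<in> C' x" "c' \<in> C' y" for c c'
        using that outer.cluster_subset xy by (intro disjoint_family_onD[OF disjoint_clusters]) auto
      then show "(\<Union>c\<in>C' x. C c) \<inter> (\<Union>c\<in>C' y. C c) = {}" by blast
    qed
    fix x assume x: "x \<in> V'"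
    note C' = outer.cluster_subset[OF x] outer.finite_cluster[OF x]
    show "(\<Union>c\<in>C' x. C c) \<subseteq> W" "finite (\<Union>c\<in>C' x. C c)"
      using C' cluster_subset finite_cluster by auto
    have "card (\<Union>c\<in>C' x. C c) \<le> card (C' x) * g" by (rule card_UN_clusters_le[OF C'(2,1)])
    also have "\<dots> \<le> g * k"
      using outer.card_cluster_le[OF x] one_le_bound mult_right_mono[of "card (C' x)" k g]
      by (simp add: mult.commute)
    finally show "card (\<Union>c\<in>C' x. C c) \<le> g * k" .
    show "connected_rel E (\<Union>c\<in>C' x. C c)"
      using outer.connected_cluster[OF x] connected_cluster C'(1) by (intro connected_rel_UN) auto
  qed
qed

lemma sparse_upto_quotient_rel:
  assumes "finite E" "sparse_upto E N \<delta>" "0 \<le> \<delta>"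
  shows "sparse_upto (quotient_rel E C V) (N / g) (g * \<delta>)"
  unfolding sparse_upto_def
proof (intro allI impI)
  fix S :: "'w set" assume S: "finite S \<and> card S \<le> N / g"
  define U where "U = (\<Union>x \<in> S \<inter> V. C x)"
  let ?Q = "quotient_rel E C V \<inter> S \<times> S"
  have "0 < g" using one_le_bound by simp
  have "finite U" unfolding U_def using S finite_cluster by auto
  have "card U \<le> card (S \<inter> V) * g" unfolding U_def using S by (intro card_UN_clusters_le) auto
  also have "\<dots> \<le> card S * g" using S \<open>0 < g\<close> by (simp add: card_mono)
  finally have card_U: "card U \<le> card S * g" .
  also have "\<dots> \<le> N" using S \<open>0 < g\<close> by (simp add: field_simps)
  finally have "card (E \<inter> U \<times> U) \<le> \<delta> * card U"
    using assms(2) \<open>finite U\<close> unfolding sparse_upto_def by blast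
  also have "\<dots> \<le> \<delta> * (card S * g)" using card_U assms(3) by (intro mult_left_mono)
  finally have sparse: "card (E \<inter> U \<times> U) \<le> g * \<delta> * card S" by (simp add: mult_ac)
  have "card ?Q \<le> card (E \<inter> U \<times> U)"
  proof (rule card_le_if_inj_on_rel[where r = "\<lambda>p e. fst e \<in> C (fst p) \<and> snd e \<in> C (snd p)"])
    fix p assume "p \<in> ?Q"
    then show "\<exists>e. e \<in> E \<inter> U \<times> U \<and> fst e \<in> C (fst p) \<and> snd e \<in> C (snd p)"
      unfolding quotient_rel_def U_def by force
  next
    fix p q e
    assume "p \<in> ?Q" "q \<in> ?Q" and "fst e \<in> C (fst p) \<and> snd e \<in> C (snd p)"
      "fst e \<in> C (fst q) \<and> snd e \<in> C (snd q)"
    moreover have "x = y" if "x \<in> V" "y \<in> V" "u \<in> C x" "u \<in> C y" for x y u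
      using that disjoint_clusters unfolding disjoint_family_on_def by blast
    ultimately show "p = q" unfolding quotient_rel_def by (auto intro: prod_eqI)
  qed (use assms(1) in simp)
  then show "card ?Q \<le> g * \<delta> * card S" using sparse by linarith
qed

end

lemma dense_contraction_mono:
  assumes "dense_contraction E W g D" "E \<subseteq> E'" "W \<subseteq> W'" "D' \<le> D"
  shows "dense_contraction E' W' g D'"
proof -
  obtain C and V :: "'a set"
    where C: "clustering E W C V g" "D * card V \<le> card (quotient_rel E C V)"
    using assms(1) unfolding dense_contraction_def by blast
  have "D' * card V \<le> D * card V" using assms(4) by (rule mult_right_mono) simp
  also note C(2)
  also have "real (card (quotient_rel E C V)) \<le> card (quotient_rel E' C V)"
    using clustering.finite_index[OF C(1)] assms(2)
    by (intro of_nat_mono card_mono finite_quotient_rel quotient_rel_mono)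
  finally show ?thesis
    using clustering_mono[OF C(1) assms(2,3)] unfolding dense_contraction_def by blast
qed

lemma dense_contraction_compose:
  fixes E :: "('v \<times> 'v) set" and V :: "'v set"
  assumes "clustering E W C V g" "dense_contraction (quotient_rel E C V) V k D"
  shows "dense_contraction E W (g * k) D"
proof -
  obtain C' and V' :: "'v set" where C': "clustering (quotient_rel E C V) V C' V' k"
    "D * card V' \<le> card (quotient_rel (quotient_rel E C V) C' V')"
    using assms(2) unfolding dense_contraction_def by blast
  note C'(2)
  also have "real (card (quotient_rel (quotient_rel E C V) C' V'))
      \<le> card (quotient_rel E (\<lambda>x. \<Union>c\<in>C' x. C c) V')"
    using clustering.finite_index[OF C'(1)]
    by (intro of_nat_mono card_mono finite_quotient_rel quotient_rel_quotient_rel_subset)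
  finally show ?thesis
    using clustering.compose[OF assms(1) C'(1)] unfolding dense_contraction_def by blast
qed

lemma (in clustering) card_overlap_rel_cluster_rel_le:
  fixes d s \<delta> N :: real and K :: nat
  assumes "finite E" "sparse_upto E N \<delta>" "finite X"
    and low: "d \<le> card (cluster_rel E C V `` {x})" and up: "card (E `` {x}) * g \<le> s"
    and "1 \<le> K" "4 \<le> d" "0 < \<delta>" "8 * K * \<delta> \<le> d" "32 * K * s * \<delta> \<le> d\<^sup>2" and N: "3 * s \<le> N"
  shows "card (overlap_rel (cluster_rel E C V) (d / (4 * K)) `` {x} \<inter> X) \<le> d / 4"
proof -
  let ?F = "cluster_rel E C V"
  have "?F `` {x} \<subseteq> V" unfolding cluster_rel_def by auto
  have card_F: "card (?F `` {x}) \<le> card (E `` {x})"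
    by (rule card_cluster_rel_Image_le[OF assms(1) disjoint_clusters])
  have "card (\<Union>y \<in> ?F `` {x}. C y) \<le> card (?F `` {x}) * g"
    using \<open>?F `` {x} \<subseteq> V\<close> finite_index by (intro card_UN_clusters_le) (auto intro: finite_subset)
  also have "\<dots> \<le> card (E `` {x}) * g" using card_F one_le_bound by (intro mult_right_mono) auto
  also have "\<dots> \<le> s" by (rule up)
  finally have small: "card (\<Union>y \<in> ?F `` {x}. C y) \<le> s" .
  have "1 * 1 \<le> card (E `` {x}) * g"
    using low card_F one_le_bound \<open>4 \<le> d\<close> by (intro mult_mono) auto
  then have "1 \<le> s" using up by linarith
  have "2 * \<delta> \<le> d / (4 * K)" using \<open>1 \<le> K\<close> \<open>8 * K * \<delta> \<le> d\<close> by (simp add: field_simps)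
  have "card (overlap_rel ?F (d / (4 * K)) `` {x} \<inter> X) \<le> 2 * \<delta> * s / (d / (4 * K))"
    by (rule card_overlap_rel_Image_le[OF assms(1-3) finite_index disjoint_clusters finite_cluster
        small \<open>1 \<le> s\<close> N \<open>0 < \<delta>\<close> \<open>2 * \<delta> \<le> d / (4 * K)\<close>])
  also have "\<dots> \<le> d / 4"
    using \<open>1 \<le> K\<close> \<open>4 \<le> d\<close> \<open>32 * K * s * \<delta> \<le> d\<^sup>2\<close> by (simp add: field_simps power2_eq_square)
  finally show ?thesis .
qed

lemma dense_contraction_attach_leaves:
  fixes E :: "('v \<times> 'v) set" and Y :: "'v set" and a :: real
  assumes "sym E" and C: "clustering E W C Y g" and X: "X \<subseteq> W" "\<And>y. y \<in> Y \<Longrightarrow> C y \<inter> X = {}"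
    and ST: "S \<noteq> {}" "S \<subseteq> T" "T \<subseteq> Y" "card T \<le> 2 * card S"
    and Z: "disjoint_family_on Z S" "\<And>y. y \<in> S \<Longrightarrow> Z y \<subseteq> X" "\<And>y. y \<in> S \<Longrightarrow> finite (Z y)"
      "\<And>y. y \<in> S \<Longrightarrow> card (Z y) \<le> K" "\<And>y z. \<lbrakk>y \<in> S; z \<in> Z y\<rbrakk> \<Longrightarrow> (z, y) \<in> cluster_rel E C Y"
    and a: "0 \<le> a" "\<And>y. y \<in> S \<Longrightarrow> a \<le> card (cluster_rel E C Y `` Z y \<inter> T - {y})"
  shows "dense_contraction E W (g + K) (a / 2)"
proof -
  let ?F = "cluster_rel E C Y"
  define C' where "C' y = C y \<union> (if y \<in> S then Z y else {})" for y
  have "finite T" using ST(3) clustering.finite_index[OF C] by (rule finite_subset)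
  have "clustering E W C' T (g + K)"
    unfolding C'_def
  proof (rule clustering.attach_leaves[OF clustering_restrict[OF C]])
    show "disjoint_family_on (\<lambda>y. if y \<in> S then Z y else {}) T"
      using Z(1) unfolding disjoint_family_on_def by auto
    show "(z, y) \<in> cluster_rel E C T" if "y \<in> T" "z \<in> (if y \<in> S then Z y else {})" for y z
      using that Z(5)[of y z] unfolding cluster_rel_def by (auto split: if_splits)
    show "(if y \<in> S then Z y else {}) \<inter> C y' = {}" if "y \<in> T" "y' \<in> T" for y y'
      using Z(2)[of y] X(2)[of y'] that ST(3) by auto
    show "(if y \<in> S then Z y else {}) \<subseteq> W" for y using Z(2)[of y] X(1) by auto
  qed (use ST Z(3,4) assms(1) in auto)
  moreover have "a / 2 * card T \<le> card (quotient_rel E C' T)"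
  proof -
    have "a / 2 * card T \<le> a / 2 * real (2 * card S)"
      using ST(4) a(1) by (intro mult_left_mono of_nat_mono) auto
    also have "\<dots> = card S * a" by simp
    also have "\<dots> \<le> (\<Sum>y\<in>S. real (card (?F `` Z y \<inter> T - {y})))"
      by (rule sum_bounded_below) (rule a(2))
    also have "\<dots> = card (SIGMA y:S. ?F `` Z y \<inter> T - {y})"
      using \<open>finite T\<close> ST(2) by (simp add: finite_subset)
    also have "\<dots> \<le> card (quotient_rel E C' T)"
    proof (intro of_nat_mono card_mono finite_quotient_rel[OF \<open>finite T\<close>])
      show "(SIGMA y:S. ?F `` Z y \<inter> T - {y}) \<subseteq> quotient_rel E C' T"
        using ST(2) unfolding cluster_rel_def quotient_rel_def C'_def by fastforce
    qed
    finally show ?thesis .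
  qed
  ultimately show ?thesis unfolding dense_contraction_def by blast
qed

lemma star_contraction:
  fixes E :: "('v \<times> 'v) set" and Y :: "'v set" and d g s \<delta> N :: real and K :: nat
  assumes "finite E" "sym E" "sparse_upto E N \<delta>" and C: "clustering E W C Y g"
    and X: "finite X" "X \<subseteq> W" "\<And>y. y \<in> Y \<Longrightarrow> C y \<inter> X = {}"
    and low: "\<And>x. x \<in> X \<Longrightarrow> d \<le> card (cluster_rel E C Y `` {x})"
    and up: "\<And>x. x \<in> X \<Longrightarrow> card (E `` {x}) * g \<le> s"
    and many: "(K + 1) * card Y < card X"
    and bounds: "1 \<le> K" "4 \<le> d" "0 < \<delta>" "8 * K * \<delta> \<le> d" "32 * K * s * \<delta> \<le> d\<^sup>2" "3 * s \<le> N"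
  shows "dense_contraction E W (g + K) (K * d / 8)"
proof -
  interpret clustering E W C Y g by fact
  let ?F = "cluster_rel E C Y"
  have few_overlaps: "card (overlap_rel ?F (d / (4 * K)) `` {x} \<inter> X) \<le> d / 4" if "x \<in> X" for x
    by (rule card_overlap_rel_cluster_rel_le[OF assms(1,3) X(1) low[OF that] up[OF that] bounds])
  have "?F `` X \<subseteq> Y" unfolding cluster_rel_def by auto
  obtain S T Z where ST: "S \<noteq> {}" "S \<subseteq> T" "T \<subseteq> Y" "card T \<le> 2 * card S"
    and Z: "disjoint_family_on Z S" "\<And>y. y \<in> S \<Longrightarrow> Z y \<subseteq> X" "\<And>y. y \<in> S \<Longrightarrow> card (Z y) = K"
      "\<And>y z. \<lbrakk>y \<in> S; z \<in> Z y\<rbrakk> \<Longrightarrow> (z, y) \<in> ?F"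
      "\<And>y. y \<in> S \<Longrightarrow> K * d / 4 \<le> card (?F `` Z y \<inter> T - {y})"
    using ex_expanding_stars[OF X(1) finite_index \<open>?F `` X \<subseteq> Y\<close> low bounds(2,1) few_overlaps many]
    by blast
  have "dense_contraction E W (g + K) (K * d / 4 / 2)"
  proof (rule dense_contraction_attach_leaves[OF assms(2) C X(2,3) ST Z(1,2) _ _ Z(4) _ Z(5)])
    show "finite (Z y)" "card (Z y) \<le> K" if "y \<in> S" for y
      using Z(3)[OF that] bounds(1) by (auto intro: card_ge_0_finite)
    show "0 \<le> K * d / 4" using bounds(2) by (intro divide_nonneg_pos mult_nonneg_nonneg) auto
  qed
  then show ?thesis by simp
qed

section \<open>Star packings in almost regular bipartite relations\<close>

definition star_packing ::
    "('v \<times> 'v) set \<Rightarrow> ('v \<times> 'v) set \<Rightarrow> nat \<Rightarrow> 'v set \<Rightarrow> ('v \<Rightarrow> 'v set) \<Rightarrow> bool" where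
  "star_packing E R L S Z \<longleftrightarrow> disjoint_family_on Z S \<and>
     (\<forall>p\<in>S. Z p \<subseteq> E `` {p} \<and> card (Z p) = L \<and> R \<inter> Z p \<times> Z p = {})"

lemma card_UN_star_packing:
  assumes "star_packing E R L S Z" "finite S" "\<And>p. p \<in> S \<Longrightarrow> finite (E `` {p})"
  shows "card (\<Union>p\<in>S. Z p) = card S * L"
proof -
  have "finite (Z p)" if "p \<in> S" for p
    using assms(1) that finite_subset[OF _ assms(3)[OF that], of "Z p"]
    unfolding star_packing_def by simp
  then have "card (\<Union>p\<in>S. Z p) = (\<Sum>p\<in>S. card (Z p))"
    using assms(1,2) unfolding star_packing_def disjoint_family_on_def
    by (intro card_UN_disjoint) auto
  then show ?thesis using assms(1) unfolding star_packing_def by simp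
qed

lemma star_packing_insert:
  assumes "star_packing E R L S Z" "p \<notin> S"
    and "Y \<subseteq> E `` {p} - (\<Union>q\<in>S. Z q)" "card Y = L" "R \<inter> Y \<times> Y = {}"
  shows "star_packing E R L (insert p S) (Z(p := Y))"
  using assms unfolding star_packing_def disjoint_family_on_def by auto

lemma ex_maximal_star_packing:
  fixes m :: real
  assumes "finite A" "sym R" "irrefl R" "0 \<le> m" and fin: "\<And>p. p \<in> A \<Longrightarrow> finite (E `` {p})"
    and degree: "\<And>p z. \<lbrakk>p \<in> A; z \<in> E `` {p}\<rbrakk> \<Longrightarrow> card (R `` {z} \<inter> E `` {p}) \<le> m"
  obtains S Z where "S \<subseteq> A" "star_packing E R L S Z"
    and "\<And>p. p \<in> A - S \<Longrightarrow> card (E `` {p} - (\<Union>q\<in>S. Z q)) \<le> L * (m + 1)"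
proof -
  define packing where "packing q \<longleftrightarrow> fst q \<subseteq> A \<and> star_packing E R L (fst q) (snd q)" for q
  have "packing ({}, \<lambda>_. {})" by (simp add: packing_def star_packing_def disjoint_family_on_def)
  moreover have "\<forall>q. packing q \<longrightarrow> card (fst q) < card A + 1"
    using card_mono[OF assms(1)] by (auto simp: packing_def less_Suc_eq_le)
  ultimately have "\<exists>q. packing q \<and> (\<forall>q'. packing q' \<longrightarrow> card (fst q') \<le> card (fst q))"
    by (rule ex_has_greatest_nat)
  then obtain S Z where "packing (S, Z)" and maximal: "\<And>S' Z'. packing (S', Z') \<Longrightarrow> card S' \<le> card S"
    by auto
  then have SZ: "S \<subseteq> A" "star_packing E R L S Z" unfolding packing_def by simp_all
  have "card (E `` {p} - (\<Union>q\<in>S. Z q)) \<le> L * (m + 1)" if p: "p \<in> A - S" for p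
  proof (rule ccontr)
    let ?U = "E `` {p} - (\<Union>q\<in>S. Z q)"
    assume "\<not> ?thesis"
    then have "L * (m + 1) \<le> card ?U" by simp
    moreover have "card (R `` {z} \<inter> ?U) \<le> m" if "z \<in> ?U" for z
    proof -
      have "card (R `` {z} \<inter> ?U) \<le> card (R `` {z} \<inter> E `` {p})"
        using fin p by (intro card_mono) auto
      then show ?thesis using degree[of p z] p that by simp
    qed
    ultimately obtain Y where "Y \<subseteq> ?U" "card Y = L" "R \<inter> Y \<times> Y = {}"
      using ex_independent_subset[of ?U R m L] fin p assms(2-4) by auto
    then have "packing (insert p S, Z(p := Y))"
      using star_packing_insert[OF SZ(2)] SZ(1) p unfolding packing_def by simp
    then have "card (insert p S) \<le> card S" by (rule maximal)
    then show False using p finite_subset[OF SZ(1) assms(1)] by simp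
  qed
  then show thesis using that SZ by blast
qed

locale near_regular_bipartite =
  fixes E :: "('v \<times> 'v) set" and A B :: "'v set" and d \<Gamma> \<delta> N :: real and K L :: nat
  assumes finite_sides: "finite A" "finite B"
    and disjoint_sides: "A \<inter> B = {}"
    and nonempty: "A \<union> B \<noteq> {}"
    and edges_between: "E \<subseteq> A \<times> B \<union> B \<times> A"
    and sym: "sym E"
    and sparse: "sparse_upto E N \<delta>"
    and degree_ge: "v \<in> A \<union> B \<Longrightarrow> d \<le> card (E `` {v})"
    and degree_le: "v \<in> A \<union> B \<Longrightarrow> card (E `` {v}) \<le> \<Gamma> * d"
    and one_le: "1 \<le> \<Gamma>" "1 \<le> \<delta>" "1 \<le> K"
    and L_large: "16 * \<Gamma> ^ 3 * (real K + 2) \<le> L"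
    and d_large: "8192 * (\<Gamma>\<^sup>2 * (real L + 1)\<^sup>2) * \<delta> \<le> d"
    and N_large: "3 * (\<Gamma> * d * (real L + 1)) \<le> N"
begin

lemma finite_edges: "finite E"
  using edges_between finite_sides by (rule_tac finite_subset[of E "A \<times> B \<union> B \<times> A"]) auto

lemma neighbours: "p \<in> A \<Longrightarrow> E `` {p} \<subseteq> B" "z \<in> B \<Longrightarrow> E `` {z} \<subseteq> A"
  using edges_between disjoint_sides by auto

lemma L_bounds: "4 * \<Gamma> \<le> L" "\<Gamma> * K \<le> L" "1 \<le> L"
proof -
  have "\<Gamma> ^ 1 \<le> \<Gamma> ^ 3" using one_le by (intro power_increasing) auto
  then have "16 * \<Gamma> * (real K + 2) \<le> 16 * \<Gamma> ^ 3 * (real K + 2)" by (intro mult_right_mono) auto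
  with L_large have large: "16 * (\<Gamma> * K) + 32 * \<Gamma> \<le> L" by (simp add: algebra_simps)
  moreover have "0 \<le> \<Gamma> * K" using one_le by simp
  ultimately show "4 * \<Gamma> \<le> L" "\<Gamma> * K \<le> L" using one_le by linarith+
  then show "1 \<le> L" using one_le by linarith
qed

lemma d_dominates:
  assumes "c \<le> \<Gamma>\<^sup>2 * (real L + 1)\<^sup>2"
  shows "8192 * c * \<delta> \<le> d"
proof -
  have "8192 * c * \<delta> \<le> 8192 * (\<Gamma>\<^sup>2 * (real L + 1)\<^sup>2) * \<delta>"
    using assms one_le by (intro mult_right_mono) auto
  then show ?thesis using d_large by linarith
qed

lemma d_ge: "64 * \<Gamma> \<le> d"
proof -
  have "\<Gamma> * 1 \<le> \<Gamma>\<^sup>2 * (real L + 1)\<^sup>2"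
    using one_le by (intro mult_mono self_le_power one_le_power) auto
  then have "8192 * (\<Gamma> * \<delta>) \<le> d" using d_dominates[of \<Gamma>] by (simp add: mult.assoc)
  moreover have "\<Gamma> * 1 \<le> \<Gamma> * \<delta>" using one_le by (intro mult_left_mono) auto
  ultimately show ?thesis using one_le by linarith
qed

lemma card_sides_le: "card A \<le> \<Gamma> * card B" "card B \<le> \<Gamma> * card A"
proof -
  have "card A * d \<le> card B * (\<Gamma> * d)"
    by (intro card_le_by_degrees[of A B E] finite_sides finite_edges sym neighbours
        degree_ge degree_le UnI1 UnI2)
  moreover have "card B * d \<le> card A * (\<Gamma> * d)"
    by (intro card_le_by_degrees[of B A E] finite_sides finite_edges sym neighbours
        degree_ge degree_le UnI1 UnI2)
  ultimately have "card A * d \<le> (\<Gamma> * card B) * d" "card B * d \<le> (\<Gamma> * card A) * d"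
    by (simp_all add: mult_ac)
  then show "card A \<le> \<Gamma> * card B" "card B \<le> \<Gamma> * card A"
    using d_ge one_le by (simp_all only: mult_le_cancel_right)
qed

lemma card_B_pos: "0 < card B"
  using nonempty finite_sides card_sides_le(1) by (cases "B = {}") (auto simp: card_gt_0_iff)

definition conflicts :: "('v \<times> 'v) set" where
  "conflicts = overlap_rel E (d / (2 * L))"

lemma card_conflicts_le:
  assumes "v \<in> A \<union> B"
  shows "card (conflicts `` {v} \<inter> (A \<union> B)) \<le> 4 * \<delta> * \<Gamma> * L"
proof -
  have all: "cluster_rel E (\<lambda>y. {y}) (A \<union> B) = E"
    using edges_between unfolding cluster_rel_def by auto
  have "1 * 1 \<le> \<Gamma> * d" using d_ge one_le by (intro mult_mono) auto
  moreover from this have "\<Gamma> * d * 1 \<le> \<Gamma> * d * (real L + 1)" by (intro mult_left_mono) auto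
  ultimately have \<Gamma>d: "1 \<le> \<Gamma> * d" "3 * (\<Gamma> * d) \<le> N" using N_large by linarith+
  have "real L \<le> (real L + 1)\<^sup>2" by (simp add: power2_eq_square algebra_simps)
  then have "real L * 1 \<le> (real L + 1)\<^sup>2 * \<Gamma>\<^sup>2" using one_le by (intro mult_mono one_le_power) auto
  then have "8192 * (L * \<delta>) \<le> d" using d_dominates[of L] by (simp add: mult_ac)
  moreover have "0 \<le> L * \<delta>" using one_le by simp
  ultimately have "4 * (L * \<delta>) \<le> d" by linarith
  have "card (overlap_rel (cluster_rel E (\<lambda>y. {y}) (A \<union> B)) (d / (2 * L)) `` {v} \<inter> (A \<union> B))
      \<le> 2 * \<delta> * (\<Gamma> * d) / (d / (2 * L))"
  proof (rule card_overlap_rel_Image_le[OF finite_edges sparse])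
    show "card (\<Union>y \<in> cluster_rel E (\<lambda>y. {y}) (A \<union> B) `` {v}. {y}) \<le> \<Gamma> * d"
      unfolding all using degree_le[OF assms] by simp
    show "2 * \<delta> \<le> d / (2 * L)"
      using \<open>4 * (L * \<delta>) \<le> d\<close> L_bounds(3) by (simp add: field_simps)
  qed (use finite_sides one_le \<Gamma>d in \<open>auto simp: disjoint_family_on_def\<close>)
  also have "\<dots> = 4 * \<delta> * \<Gamma> * L" using d_ge one_le L_bounds(3) by (simp add: field_simps)
  finally show ?thesis unfolding all conflicts_def .
qed

lemma leaves_of_packing:
  assumes "S \<subseteq> A" "star_packing E conflicts L S Z"
  shows "(\<Union>p\<in>S. Z p) \<subseteq> B" "card B = card (B - (\<Union>p\<in>S. Z p)) + card S * L"
proof -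
  show leaves: "(\<Union>p\<in>S. Z p) \<subseteq> B" using assms neighbours(1) unfolding star_packing_def by blast
  have "finite S" using assms(1) finite_sides(1) by (rule finite_subset)
  then have "card (\<Union>p\<in>S. Z p) = card S * L"
    using finite_edges by (intro card_UN_star_packing[OF assms(2)]) (simp_all add: finite_Image)
  then show "card B = card (B - (\<Union>p\<in>S. Z p)) + card S * L"
    using leaves finite_sides(2)
    by (metis card_Diff_subset card_mono finite_subset le_add_diff_inverse2)
qed

lemma ex_maximal_conflict_free_packing:
  obtains S Z where "S \<subseteq> A" "star_packing E conflicts L S Z"
    and "\<And>p. p \<in> A - S \<Longrightarrow> card (E `` {p} - (\<Union>q\<in>S. Z q)) \<le> 5 * \<delta> * \<Gamma> * L\<^sup>2"
proof -
  define m where "m = 4 * \<delta> * \<Gamma> * L"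
  have degree: "card (conflicts `` {z} \<inter> E `` {p}) \<le> m" if "p \<in> A" "z \<in> E `` {p}" for p z
  proof -
    have "card (conflicts `` {z} \<inter> E `` {p}) \<le> card (conflicts `` {z} \<inter> (A \<union> B))"
      using neighbours(1)[OF that(1)] finite_sides by (intro card_mono) auto
    then show ?thesis
      using card_conflicts_le[of z] neighbours(1)[OF that(1)] that(2) unfolding m_def by force
  qed
  have conflicts: "sym conflicts" "irrefl conflicts"
    unfolding conflicts_def by (rule sym_overlap_rel irrefl_overlap_rel)+
  have "0 \<le> m" unfolding m_def using one_le by simp
  have "1 * 1 * 1 \<le> \<delta> * \<Gamma> * L" using one_le L_bounds(3) by (intro mult_mono) auto
  then have "m + 1 \<le> 5 * \<delta> * \<Gamma> * L" unfolding m_def by linarith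
  then have "L * (m + 1) \<le> L * (5 * \<delta> * \<Gamma> * L)" by (rule mult_left_mono) simp
  then have bound: "L * (m + 1) \<le> 5 * \<delta> * \<Gamma> * L\<^sup>2" by (simp add: power2_eq_square mult_ac)
  show thesis
    using ex_maximal_star_packing[OF finite_sides(1) conflicts \<open>0 \<le> m\<close> finite_Image[OF finite_edges]
        degree, where L = L] that bound
    by (metis order_trans)
qed

lemma card_uncovered_edges_le:
  assumes uncovered: "\<And>p. p \<in> A - S \<Longrightarrow> card (E `` {p} \<inter> R) \<le> 5 * \<delta> * \<Gamma> * L\<^sup>2"
  shows "card (E \<inter> (A - S) \<times> R) \<le> card B * d / 4"
proof -
  have "real (card (E \<inter> (A - S) \<times> R)) = (\<Sum>p\<in>A - S. real (card (E `` {p} \<inter> R)))"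
    using finite_sides finite_edges by (simp add: card_Int_Times)
  also have "\<dots> \<le> card (A - S) * (5 * \<delta> * \<Gamma> * L\<^sup>2)"
    by (rule sum_bounded_above) (rule uncovered)
  also have "\<dots> \<le> (\<Gamma> * card B) * (5 * \<delta> * \<Gamma> * L\<^sup>2)"
  proof (rule mult_right_mono)
    have "card (A - S) \<le> card A" using finite_sides by (intro card_mono) auto
    then show "card (A - S) \<le> \<Gamma> * card B" using card_sides_le(1) by linarith
  qed (use one_le in simp)
  also have "\<dots> = card B * (20 * (\<Gamma>\<^sup>2 * L\<^sup>2) * \<delta>) / 4" by (simp add: power2_eq_square)
  also have "\<dots> \<le> card B * d / 4"
  proof -
    have "\<Gamma>\<^sup>2 * L\<^sup>2 \<le> \<Gamma>\<^sup>2 * (real L + 1)\<^sup>2" by (intro mult_left_mono power_mono) auto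
    then have "8192 * (\<Gamma>\<^sup>2 * L\<^sup>2) * \<delta> \<le> d" by (rule d_dominates)
    moreover have "0 \<le> \<Gamma>\<^sup>2 * L\<^sup>2 * \<delta>" using one_le by simp
    ultimately show ?thesis by (intro divide_right_mono mult_left_mono) auto
  qed
  finally show ?thesis .
qed

text \<open>The centres of a maximal packing are so few that its stars must cover half of \<open>B\<close>.\<close>

lemma ex_covering_star_packing:
  obtains S Z where "S \<subseteq> A" "star_packing E conflicts L S Z" "card B \<le> 2 * (card S * real L)"
proof -
  obtain S Z where SZ: "S \<subseteq> A" "star_packing E conflicts L S Z"
    and maximal: "\<And>p. p \<in> A - S \<Longrightarrow> card (E `` {p} - (\<Union>q\<in>S. Z q)) \<le> 5 * \<delta> * \<Gamma> * L\<^sup>2"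
    using ex_maximal_conflict_free_packing by metis
  define R where "R = B - (\<Union>p\<in>S. Z p)"
  have card_B: "card B = card R + card S * real L"
    using leaves_of_packing(2)[OF SZ] unfolding R_def by simp
  have "card R * d \<le> card (E \<inter> R \<times> A)"
    using finite_sides finite_edges neighbours(2) degree_ge unfolding R_def
    by (intro card_Int_Times_ge) (auto simp: Int_absorb2)
  also have "\<dots> = card (E \<inter> A \<times> R)" using card_Int_Times_sym[OF sym] by simp
  also have "\<dots> \<le> real (card (E \<inter> S \<times> R)) + card (E \<inter> (A - S) \<times> R)"
  proof -
    have "E \<inter> A \<times> R = E \<inter> S \<times> R \<union> E \<inter> (A - S) \<times> R" using SZ(1) by auto
    then show ?thesis by (metis card_Un_le of_nat_add of_nat_mono)
  qed
  also have "card (E \<inter> S \<times> R) \<le> card B * d / 4"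
  proof -
    have "card (E \<inter> S \<times> R) \<le> card S * (\<Gamma> * d)"
      using SZ(1) degree_le finite_subset[OF SZ(1) finite_sides(1)]
      by (intro card_Int_Times_le finite_edges) auto
    moreover have "card S * (4 * \<Gamma>) \<le> card S * real L"
      using L_bounds(1) by (intro mult_left_mono) auto
    then have "card S * (4 * \<Gamma>) * d \<le> card B * d"
      using card_B d_ge one_le by (intro mult_right_mono) auto
    ultimately show ?thesis by simp
  qed
  also have "card (E \<inter> (A - S) \<times> R) \<le> card B * d / 4"
  proof (rule card_uncovered_edges_le)
    fix p assume "p \<in> A - S"
    have "card (E `` {p} \<inter> R) \<le> card (E `` {p} - (\<Union>q\<in>S. Z q))"
      using finite_edges unfolding R_def by (intro card_mono) (auto simp: finite_Image)
    then show "card (E `` {p} \<inter> R) \<le> 5 * \<delta> * \<Gamma> * L\<^sup>2" using maximal[OF \<open>p \<in> A - S\<close>] by linarith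
  qed
  finally have "card R * d \<le> (card B / 2) * d" by (simp add: mult.commute)
  then have "card R \<le> card B / 2" using d_ge one_le by (simp add: mult_le_cancel_right)
  then have "card B \<le> 2 * (card S * real L)" using card_B by linarith
  then show thesis using that SZ by blast
qed

lemma card_neighbours_of_leaves_ge:
  assumes "S \<subseteq> A" "star_packing E conflicts L S Z" "p \<in> S"
  shows "L * d / 2 \<le> card (E `` Z p)"
proof -
  have Z: "Z p \<subseteq> E `` {p}" "card (Z p) = L" "conflicts \<inter> Z p \<times> Z p = {}"
    using assms(2,3) unfolding star_packing_def by auto
  then have "Z p \<subseteq> B" using neighbours(1) assms(1,3) by blast
  have "card (Z p) * d - (card (Z p))\<^sup>2 * (d / (2 * L)) \<le> card (E `` Z p \<inter> UNIV)"
  proof (rule card_Image_ge_if_independent)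
    show "finite (Z p)" using \<open>Z p \<subseteq> B\<close> finite_sides(2) by (rule finite_subset)
    show "overlap_rel E (d / (2 * L)) \<inter> Z p \<times> Z p = {}" using Z(3) unfolding conflicts_def .
    show "d \<le> card (E `` {z} \<inter> UNIV)" if "z \<in> Z p" for z
      using degree_ge[of z] \<open>Z p \<subseteq> B\<close> that by auto
    show "0 \<le> d / (2 * L)" using d_ge one_le by simp
  qed (simp add: finite_edges finite_Image)
  then show ?thesis using Z(2) L_bounds(3) by (simp add: power2_eq_square field_simps)
qed

lemma card_cluster_rel_stars_ge:
  assumes "S \<subseteq> A" "star_packing E conflicts L S Z"
  shows "card S * (L * d / 4) \<le> card (cluster_rel E Z S \<inter> (A - S) \<times> UNIV)"
proof -
  let ?F = "cluster_rel E Z S"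
  have "finite S" using assms(1) finite_sides(1) by (rule finite_subset)
  have "finite ?F" using finite_edges \<open>finite S\<close> by (rule finite_cluster_rel)
  have disjoint: "disjoint_family_on Z S" using assms(2) unfolding star_packing_def by blast
  have F_Image: "?F\<inverse> `` {p} = E `` Z p" if "p \<in> S" for p
    using sym that unfolding cluster_rel_def by (auto dest: symD)
  have "card S * (L * d / 2) \<le> card (?F\<inverse> \<inter> S \<times> UNIV)"
    using card_neighbours_of_leaves_ge[OF assms] F_Image \<open>finite S\<close> \<open>finite ?F\<close>
    by (intro card_Int_Times_ge) auto
  also have "?F\<inverse> \<inter> S \<times> UNIV = (?F \<inter> S \<times> UNIV \<union> ?F \<inter> (A - S) \<times> UNIV)\<inverse>"
  proof -
    have "?F \<subseteq> A \<times> S"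
      using neighbours(2) leaves_of_packing(1)[OF assms] sym unfolding cluster_rel_def
      by (blast dest: symD)
    then show ?thesis by blast
  qed
  also have "real (card \<dots>) \<le> card (?F \<inter> S \<times> UNIV) + card (?F \<inter> (A - S) \<times> UNIV)"
    unfolding card_inverse by (intro of_nat_mono card_Un_le)
  also have "\<dots> = real (card (?F \<inter> S \<times> UNIV)) + card (?F \<inter> (A - S) \<times> UNIV)" by simp
  also have "card (?F \<inter> S \<times> UNIV) \<le> card S * (\<Gamma> * d)"
  proof (rule card_Int_Times_le[OF \<open>finite S\<close> \<open>finite ?F\<close>])
    fix p assume "p \<in> S"
    then show "card (?F `` {p}) \<le> \<Gamma> * d"
      using card_cluster_rel_Image_le[OF finite_edges disjoint, of p] degree_le[of p] assms(1)
      by force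
  qed
  also have "card S * (\<Gamma> * d) \<le> card S * (L * d / 4)"
    using L_bounds(1) d_ge one_le mult_right_mono[of "4 * \<Gamma>" L d]
    by (intro mult_left_mono) auto
  finally show ?thesis by (simp add: field_simps)
qed

definition attachable :: "'v set \<Rightarrow> ('v \<Rightarrow> 'v set) \<Rightarrow> 'v set" where
  "attachable S Z = {q \<in> A - S. d / (16 * \<Gamma>) \<le> card (cluster_rel E Z S `` {q})}"

lemma card_cluster_rel_stars_le:
  assumes "S \<subseteq> A" "star_packing E conflicts L S Z"
  shows "card (cluster_rel E Z S \<inter> (A - S) \<times> UNIV)
    \<le> card (attachable S Z) * (\<Gamma> * d) + card A * (d / (16 * \<Gamma>))"
proof -
  let ?F = "cluster_rel E Z S" and ?c = "d / (16 * \<Gamma>)"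
  have "finite S" using assms(1) finite_sides(1) by (rule finite_subset)
  have "finite ?F" using finite_edges \<open>finite S\<close> by (rule finite_cluster_rel)
  have disjoint: "disjoint_family_on Z S" using assms(2) unfolding star_packing_def by blast
  have "0 \<le> ?c" using d_ge one_le by simp
  have "card (?F \<inter> (A - S) \<times> UNIV) \<le> card (?F \<inter> attachable S Z \<times> UNIV) + card (A - S) * ?c"
    using card_Int_Times_le_heavy[OF _ \<open>finite ?F\<close> \<open>0 \<le> ?c\<close>, of "A - S" UNIV] finite_sides
    unfolding attachable_def by simp
  also have "card (?F \<inter> attachable S Z \<times> UNIV) \<le> card (attachable S Z) * (\<Gamma> * d)"
  proof (rule card_Int_Times_le)
    fix q assume "q \<in> attachable S Z"
    then show "card (?F `` {q}) \<le> \<Gamma> * d"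
      using card_cluster_rel_Image_le[OF finite_edges disjoint, of q] degree_le[of q]
      unfolding attachable_def by force
  qed (use finite_sides \<open>finite ?F\<close> in \<open>auto simp: attachable_def\<close>)
  also have "card (A - S) * ?c \<le> card A * ?c"
    using finite_sides \<open>0 \<le> ?c\<close> by (intro mult_right_mono of_nat_mono card_mono) auto
  finally show ?thesis by simp
qed

lemma card_attachable_ge:
  assumes "S \<subseteq> A" "star_packing E conflicts L S Z" and covering: "card B \<le> 2 * (card S * real L)"
  shows "card A \<le> 16 * \<Gamma>\<^sup>2 * card (attachable S Z)"
proof -
  define x where "x = real (card (attachable S Z))"
  have "0 < d" using d_ge one_le by linarith
  have "card A * d / 8 \<le> \<Gamma> * card B * d / 8"
    using card_sides_le(1) \<open>0 < d\<close> by simp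
  also have "\<dots> \<le> \<Gamma> * (card S * (L * d / 4))"
    using covering \<open>0 < d\<close> one_le mult_right_mono[OF covering, of d] by simp
  also have "\<dots> \<le> \<Gamma> * (x * (\<Gamma> * d) + card A * (d / (16 * \<Gamma>)))"
    unfolding x_def using one_le
    by (intro mult_left_mono order_trans[OF card_cluster_rel_stars_ge[OF assms(1,2)]]
        card_cluster_rel_stars_le assms(1,2)) auto
  also have "\<dots> = \<Gamma>\<^sup>2 * x * d + card A * d / 16"
    using one_le by (simp add: field_simps power2_eq_square)
  finally have "card A * d \<le> (16 * \<Gamma>\<^sup>2 * x) * d" by (simp add: mult_ac)
  then show ?thesis unfolding x_def using \<open>0 < d\<close> by (simp only: mult_le_cancel_right)
qed

lemma many_attachable:
  assumes "S \<subseteq> A" "star_packing E conflicts L S Z" and covering: "card B \<le> 2 * (card S * real L)"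
  shows "(K + 1) * card S < card (attachable S Z)"
proof -
  let ?x = "real (card (attachable S Z))"
  have "card S * L \<le> card B"
    using leaves_of_packing(2)[OF assms(1,2)] by simp
  then have "card S * (16 * \<Gamma> ^ 3 * (real K + 2)) \<le> card B"
    using mult_left_mono[OF L_large, of "real (card S)"] by (simp flip: of_nat_mult)
  also have "card B \<le> \<Gamma> * (16 * \<Gamma>\<^sup>2 * ?x)"
    using card_sides_le(2) card_attachable_ge[OF assms] one_le
    by (meson mult_left_mono order_trans zero_le_one)
  finally have "(16 * \<Gamma> ^ 3) * ((real K + 2) * card S) \<le> (16 * \<Gamma> ^ 3) * ?x"
    by (simp add: power2_eq_square power3_eq_cube mult_ac)
  then have "(real K + 2) * card S \<le> ?x"
    by (rule mult_left_le_imp_le) (use one_le in simp)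
  then have "real ((K + 2) * card S) \<le> ?x" by (simp add: algebra_simps)
  then have "(K + 2) * card S \<le> card (attachable S Z)" by (simp only: of_nat_le_iff)
  moreover have "0 < card S" using covering card_B_pos by (cases "card S") auto
  ultimately show ?thesis by simp
qed

lemma clustering_stars:
  assumes "S \<subseteq> A" "S \<noteq> {}" "star_packing E conflicts L S Z"
  shows "clustering E (A \<union> B) (\<lambda>p. {p} \<union> Z p) S (1 + real L)"
proof (rule clustering.attach_leaves[OF clustering_singletons sym])
  have Z: "disjoint_family_on Z S" "\<And>p. p \<in> S \<Longrightarrow> Z p \<subseteq> E `` {p}" "\<And>p. p \<in> S \<Longrightarrow> card (Z p) = L"
    using assms(3) unfolding star_packing_def by auto
  then show "disjoint_family_on Z S" "\<And>p. p \<in> S \<Longrightarrow> card (Z p) \<le> L" by simp_all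
  show "finite S" using assms(1) finite_sides(1) by (rule finite_subset)
  have leaves: "Z p \<subseteq> B" if "p \<in> S" for p using leaves_of_packing(1)[OF assms(1,3)] that by blast
  then show "finite (Z p)" if "p \<in> S" for p
    using that finite_sides(2) by (blast intro: finite_subset)
  show "Z p \<subseteq> A \<union> B" if "p \<in> S" for p using leaves[OF that] by blast
  show "(z, p) \<in> cluster_rel E (\<lambda>p. {p}) S" if "p \<in> S" "z \<in> Z p" for p z
    using Z(2)[OF that(1)] that sym unfolding cluster_rel_def by (auto dest: symD)
  show "Z p \<inter> {q} = {}" if "p \<in> S" "q \<in> S" for p q
    using leaves[OF that(1)] that(2) assms(1) disjoint_sides by blast
qed (use assms in auto)

lemma d_bounds: "8 * K * \<delta> \<le> d / (16 * \<Gamma>)" "32 * K * (\<Gamma> * d * (1 + real L)) * \<delta> \<le> (d / (16 * \<Gamma>))\<^sup>2"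
proof -
  have "\<Gamma> * K \<le> real L + 1" using L_bounds(2) by simp
  also have "\<dots> = 1 * (real L + 1)" by simp
  also have "\<dots> \<le> \<Gamma>\<^sup>2 * (real L + 1)\<^sup>2"
    using one_le by (intro mult_mono one_le_power self_le_power) auto
  finally have "8192 * (\<Gamma> * K) * \<delta> \<le> d" by (rule d_dominates)
  moreover have "0 \<le> \<Gamma> * K * \<delta>" using one_le by simp
  ultimately have "128 * (\<Gamma> * K * \<delta>) \<le> d" by linarith
  then show "8 * K * \<delta> \<le> d / (16 * \<Gamma>)" using one_le by (simp add: field_simps)
  have "(\<Gamma> * K) * (\<Gamma>\<^sup>2 * (real L + 1)) \<le> (real L + 1) * (\<Gamma>\<^sup>2 * (real L + 1))"
    using L_bounds(2) by (intro mult_right_mono) auto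
  then have "8192 * (\<Gamma> ^ 3 * K * (real L + 1)) * \<delta> \<le> d"
    by (intro d_dominates) (simp add: power2_eq_square power3_eq_cube mult_ac)
  then have "8192 * (\<Gamma> ^ 3 * K * (real L + 1)) * \<delta> * d \<le> d * d"
    using d_ge one_le by (intro mult_right_mono) auto
  then show "32 * K * (\<Gamma> * d * (1 + real L)) * \<delta> \<le> (d / (16 * \<Gamma>))\<^sup>2"
    using one_le by (simp add: field_simps power2_eq_square power3_eq_cube)
qed

lemma near_regular_contraction:
  "dense_contraction E (A \<union> B) (real L + 1 + K) (K * d / (128 * \<Gamma>))"
proof -
  obtain S Z where SZ: "S \<subseteq> A" "star_packing E conflicts L S Z" "card B \<le> 2 * (card S * real L)"
    by (rule ex_covering_star_packing)
  have "S \<noteq> {}" using SZ(3) card_B_pos by auto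
  have leaves: "(\<Union>p\<in>S. Z p) \<subseteq> B" using SZ(1,2) by (rule leaves_of_packing)
  have stars: "cluster_rel E (\<lambda>p. {p} \<union> Z p) S `` {q} = cluster_rel E Z S `` {q}" if "q \<in> A" for q
    using neighbours(1)[OF that] SZ(1) disjoint_sides unfolding cluster_rel_def by blast
  have "dense_contraction E (A \<union> B) (1 + real L + K) (K * (d / (16 * \<Gamma>)) / 8)"
  proof (rule star_contraction[OF finite_edges sym sparse
        clustering_stars[OF SZ(1) \<open>S \<noteq> {}\<close> SZ(2)], where X = "attachable S Z"])
    show "finite (attachable S Z)" "attachable S Z \<subseteq> A \<union> B"
      using finite_sides unfolding attachable_def by auto
    show "({p} \<union> Z p) \<inter> attachable S Z = {}" if "p \<in> S" for p
      using leaves that disjoint_sides unfolding attachable_def by blast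
    show "d / (16 * \<Gamma>) \<le> card (cluster_rel E (\<lambda>p. {p} \<union> Z p) S `` {q})"
      if "q \<in> attachable S Z" for q
      using that stars unfolding attachable_def by simp
    show "card (E `` {q}) * (1 + real L) \<le> \<Gamma> * d * (1 + real L)" if "q \<in> attachable S Z" for q
      using that degree_le[of q] unfolding attachable_def by (intro mult_right_mono) auto
    show "4 \<le> d / (16 * \<Gamma>)" using d_ge one_le by (simp add: le_divide_eq)
  qed (use many_attachable[OF SZ] one_le N_large d_bounds in \<open>auto simp: add.commute\<close>)
  then show ?thesis by (simp add: add_ac)
qed

end

section \<open>One round of contraction\<close>

definition crossing :: "'v set \<Rightarrow> ('v \<times> 'v) set" where
  "crossing P = P \<times> (- P) \<union> (- P) \<times> P"

lemma card_crossing_insert: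
  assumes "finite V" "finite E" "sym E" "irrefl E" "v \<notin> V" "P \<subseteq> V"
  shows "card (E \<inter> crossing P \<inter> insert v V \<times> insert v V)
      = card (E \<inter> crossing P \<inter> V \<times> V) + 2 * card (E `` {v} \<inter> V \<inter> P)" (is ?out)
    and "card (E \<inter> crossing (insert v P) \<inter> insert v V \<times> insert v V)
      = card (E \<inter> crossing P \<inter> V \<times> V) + 2 * card (E `` {v} \<inter> V - P)" (is ?in)
proof -
  have insert_cut: "card (E \<inter> crossing Q \<inter> insert v V \<times> insert v V)
      = card (E \<inter> crossing Q \<inter> V \<times> V) + 2 * card ((E \<inter> crossing Q) `` {v} \<inter> V)" for Q
    using assms by (intro card_Int_insert_square) (auto simp: crossing_def sym_def irrefl_def)
  have "v \<notin> P" using assms(5,6) by blast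
  then have "(E \<inter> crossing P) `` {v} \<inter> V = E `` {v} \<inter> V \<inter> P"
    unfolding crossing_def by auto
  then show ?out using insert_cut[of P] by simp
  have "E \<inter> crossing (insert v P) \<inter> V \<times> V = E \<inter> crossing P \<inter> V \<times> V"
    "(E \<inter> crossing (insert v P)) `` {v} \<inter> V = E `` {v} \<inter> V - P"
    using assms(5) \<open>v \<notin> P\<close> unfolding crossing_def by auto
  then show ?in using insert_cut[of "insert v P"] by simp
qed

lemma ex_half_cut:
  assumes "finite V" "E \<subseteq> V \<times> V" "sym E" "irrefl E"
  shows "\<exists>P. card E \<le> 2 * card (E \<inter> crossing P)"
proof -
  have "finite E" using assms(1,2) by (meson finite_SigmaI finite_subset)
  have "\<exists>P\<subseteq>V. card (E \<inter> V \<times> V) \<le> 2 * card (E \<inter> crossing P \<inter> V \<times> V)"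
    using assms(1)
  proof (induction V rule: finite_induct)
    case (insert v V)
    then obtain P where P: "P \<subseteq> V" "card (E \<inter> V \<times> V) \<le> 2 * card (E \<inter> crossing P \<inter> V \<times> V)"
      by blast
    let ?N = "E `` {v} \<inter> V"
    have all: "card (E \<inter> insert v V \<times> insert v V) = card (E \<inter> V \<times> V) + 2 * card ?N"
      using assms(4) by (intro card_Int_insert_square insert.hyps \<open>finite E\<close> assms(3))
        (simp add: irrefl_def)
    note cuts = card_crossing_insert[OF insert.hyps(1) \<open>finite E\<close> assms(3,4) insert.hyps(2) P(1)]
    have "card ?N = card (?N \<inter> P) + card (?N - P)"
      using insert.hyps(1) by (intro card_Int_Diff) simp
    then consider "card ?N \<le> 2 * card (?N \<inter> P)" | "card ?N \<le> 2 * card (?N - P)" by linarith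
    then show ?case
    proof cases
      case 1
      then show ?thesis using cuts(1) all P by (intro exI[of _ P]) auto
    next
      case 2
      then show ?thesis using cuts(2) all P by (intro exI[of _ "insert v P"]) auto
    qed
  qed simp
  moreover have "E \<inter> V \<times> V = E" using assms(2) by blast
  moreover have "E \<inter> crossing P \<inter> V \<times> V = E \<inter> crossing P" for P using assms(2) by blast
  ultimately show ?thesis by auto
qed

lemma ex_densest_subset:
  assumes "finite V" "V \<noteq> {}"
  obtains W and \<rho> :: real where "W \<subseteq> V" "W \<noteq> {}" "card (E \<inter> W \<times> W) = \<rho> * card W"
    and "sparse_within E V \<rho>"
proof -
  define density where "density S = real (card (E \<inter> S \<times> S)) / card S" for S
  define densities where "densities = density ` (Pow V - {{}})"
  have fin: "finite densities" "densities \<noteq> {}" unfolding densities_def using assms by auto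
  then have "Max densities \<in> densities" by (rule Max_in)
  then obtain W where W: "W \<subseteq> V" "W \<noteq> {}" "Max densities = density W"
    unfolding densities_def by auto
  have "sparse_within E V (density W)"
    unfolding sparse_within_def
  proof (intro allI impI)
    fix S assume "S \<subseteq> V"
    show "real (card (E \<inter> S \<times> S)) \<le> density W * real (card S)"
    proof (cases "S = {}")
      case False
      then have "density S \<le> density W"
        using Max_ge[OF fin(1), of "density S"] W(3) \<open>S \<subseteq> V\<close> unfolding densities_def by simp
      moreover have "0 < card S"
        using False \<open>S \<subseteq> V\<close> assms(1) by (meson card_gt_0_iff finite_subset)
      ultimately show ?thesis by (simp add: density_def[of S] divide_le_eq)
    qed simp
  qed
  moreover have "card (E \<inter> W \<times> W) = density W * card W"
    using W(1,2) assms(1) finite_subset[of W V] by (simp add: density_def)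
  ultimately show thesis using that W by blast
qed

lemma degree_in_densest_ge:
  fixes \<rho> :: real
  assumes "finite W" "finite E" "sym E" "irrefl E"
    and "card (E \<inter> W \<times> W) = \<rho> * card W" "sparse_within E W \<rho>" "v \<in> W"
  shows "\<rho> / 2 \<le> card (E `` {v} \<inter> W)"
proof -
  let ?W = "W - {v}"
  have "card (E \<inter> insert v ?W \<times> insert v ?W) = card (E \<inter> ?W \<times> ?W) + 2 * card (E `` {v} \<inter> ?W)"
    using assms by (intro card_Int_insert_square) (auto simp: irrefl_def)
  also have "insert v ?W = W" using assms(7) by auto
  also have "E `` {v} \<inter> ?W = E `` {v} \<inter> W" using assms(4) by (auto simp: irrefl_def)
  finally have "\<rho> * card W = real (card (E \<inter> ?W \<times> ?W)) + 2 * real (card (E `` {v} \<inter> W))"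
    using assms(5) by simp
  moreover have "card (E \<inter> ?W \<times> ?W) \<le> \<rho> * card ?W"
    using assms(6) unfolding sparse_within_def by blast
  moreover have "real (card W) = real (card ?W) + 1"
    using card_Suc_Diff1[OF assms(1,7)] by linarith
  then have "\<rho> * card W = \<rho> * card ?W + \<rho>" by (simp only: distrib_left mult_1_right)
  ultimately show ?thesis by linarith
qed

lemma bounded_degree_contraction:
  fixes E :: "('v \<times> 'v) set" and d \<Gamma> \<delta> N :: real and K L :: nat
  assumes "finite S" "S \<noteq> {}" "E \<subseteq> S \<times> S" "E \<subseteq> crossing P" "sym E"
    and sparse: "sparse_upto E N \<delta>" and dense: "2 * d * card S \<le> card E"
    and degree: "\<And>v. v \<in> S \<Longrightarrow> card (E `` {v}) \<le> \<Gamma> * d"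
    and "1 \<le> \<Gamma>" "1 \<le> \<delta>" "1 \<le> K" "16 * \<Gamma> ^ 3 * (real K + 2) \<le> L"
    and "8192 * (\<Gamma>\<^sup>2 * (real L + 1)\<^sup>2) * \<delta> \<le> d" "3 * (\<Gamma> * d * (real L + 1)) \<le> N"
  shows "dense_contraction E S (real L + 1 + K) (K * d / (128 * \<Gamma>))"
proof -
  have "finite E" using assms(1,3) by (meson finite_SigmaI finite_subset)
  have "irrefl E" using assms(4) by (auto simp: crossing_def irrefl_def)
  obtain W and \<rho> :: real where W: "W \<subseteq> S" "W \<noteq> {}" and densest: "card (E \<inter> W \<times> W) = \<rho> * card W"
    and within: "sparse_within E S \<rho>"
    using ex_densest_subset[OF assms(1,2), of E] .
  have "finite W" using W(1) assms(1) by (rule finite_subset)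
  have "E \<inter> S \<times> S = E" using assms(3) by blast
  then have "card E \<le> \<rho> * card S" using within unfolding sparse_within_def by (metis order_refl)
  then have "2 * d * card S \<le> \<rho> * card S" using dense by linarith
  then have "2 * d \<le> \<rho>" using assms(1,2) by (simp add: card_gt_0_iff)
  define E' where "E' = E \<inter> W \<times> W"
  have E': "E' \<subseteq> E" "finite E'" unfolding E'_def using \<open>finite E\<close> by auto
  have Image: "E' `` {v} = E `` {v} \<inter> W" if "v \<in> W" for v using that unfolding E'_def by auto
  interpret near_regular_bipartite E' "W \<inter> P" "W - P" d \<Gamma> \<delta> N K L
  proof
    show "finite (W \<inter> P)" "finite (W - P)" "W \<inter> P \<inter> (W - P) = {}" "W \<inter> P \<union> (W - P) \<noteq> {}"
      using \<open>finite W\<close> W(2) by auto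
    show "E' \<subseteq> (W \<inter> P) \<times> (W - P) \<union> (W - P) \<times> (W \<inter> P)"
      using assms(4) unfolding E'_def crossing_def by auto
    show "sym E'" using assms(5) unfolding E'_def by (auto simp: sym_def)
    show "sparse_upto E' N \<delta>" using sparse E'(1) \<open>finite E\<close> by (rule sparse_upto_mono)
    fix v assume "v \<in> W \<inter> P \<union> (W - P)"
    then have v: "v \<in> W" by blast
    have "sparse_within E W \<rho>" using within W(1) unfolding sparse_within_def by blast
    then have "\<rho> / 2 \<le> card (E' `` {v})"
      unfolding Image[OF v]
      by (rule degree_in_densest_ge[OF \<open>finite W\<close> \<open>finite E\<close> assms(5) \<open>irrefl E\<close> densest _ v])
    then show "d \<le> card (E' `` {v})" using \<open>2 * d \<le> \<rho>\<close> by linarith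
    have "card (E' `` {v}) \<le> card (E `` {v})"
      using \<open>finite E\<close> E'(1) by (intro card_mono) (auto simp: finite_Image)
    then show "card (E' `` {v}) \<le> \<Gamma> * d" using degree[of v] v W(1) by fastforce
  qed (use assms in auto)
  have "W \<inter> P \<union> (W - P) = W" by blast
  then show ?thesis using dense_contraction_mono[OF near_regular_contraction E'(1)] W(1) by simp
qed

locale densest_bipartite =
  fixes E :: "('v \<times> 'v) set" and W P :: "'v set" and \<rho> \<Lambda> :: real
  assumes finite_verts: "finite W" and nonempty: "W \<noteq> {}"
    and edges_within: "E \<subseteq> W \<times> W"
    and edges_between: "E \<subseteq> crossing P"
    and sym: "sym E"
    and card_edges: "card E = \<rho> * card W"
    and sparse_within: "sparse_within E W \<rho>"
    and positive: "0 < \<rho>"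
    and threshold: "48 \<le> \<Lambda>"
begin

definition hubs :: "'v set" where
  "hubs = {v \<in> W. \<Lambda> * \<rho> < card (E `` {v})}"

definition attached :: "'v set" where
  "attached = {v \<in> W - hubs. \<rho> / 16 \<le> card (E `` {v} \<inter> hubs)}"

lemma finite_edges: "finite E"
  using edges_within finite_verts by (meson finite_SigmaI finite_subset)

lemma card_W_pos: "0 < real (card W)"
  using finite_verts nonempty by (simp add: card_gt_0_iff)

lemma hubs_subset: "hubs \<subseteq> W" and finite_hubs: "finite hubs"
  using finite_verts unfolding hubs_def by auto

lemma card_hubs_le: "card hubs * \<Lambda> \<le> card W"
proof -
  have "card hubs * (\<Lambda> * \<rho>) \<le> card (E \<inter> hubs \<times> UNIV)"
    using finite_hubs finite_edges unfolding hubs_def by (intro card_Int_Times_ge) auto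
  also have "\<dots> \<le> card E" using finite_edges by (intro of_nat_mono card_mono) auto
  finally have "(card hubs * \<Lambda>) * \<rho> \<le> card W * \<rho>" using card_edges by (simp add: mult_ac)
  then show ?thesis using positive by (simp add: mult_le_cancel_right)
qed

lemma card_hubs_le_48: "48 * card hubs \<le> card W"
  using card_hubs_le mult_left_mono[OF threshold, of "real (card hubs)"] by simp

lemma many_hub_edges_or_low_degree_edges:
  "\<rho> * card W / 8 \<le> card (E \<inter> (W - hubs) \<times> hubs) \<or>
   \<rho> * card W / 2 \<le> card (E \<inter> (W - hubs) \<times> (W - hubs))"
proof -
  let ?S = "W - hubs"
  have "E = (E \<inter> ?S \<times> ?S \<union> E \<inter> ?S \<times> hubs) \<union> (E \<inter> hubs \<times> ?S \<union> E \<inter> hubs \<times> hubs)"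
    using edges_within hubs_subset by blast
  then have "card E = card ((E \<inter> ?S \<times> ?S \<union> E \<inter> ?S \<times> hubs) \<union> (E \<inter> hubs \<times> ?S \<union> E \<inter> hubs \<times> hubs))"
    by (rule arg_cong)
  also have "\<dots> \<le> (card (E \<inter> ?S \<times> ?S) + card (E \<inter> ?S \<times> hubs))
      + (card (E \<inter> hubs \<times> ?S) + card (E \<inter> hubs \<times> hubs))"
    by (intro order_trans[OF card_Un_le] add_mono card_Un_le)
  finally have "card E \<le> (card (E \<inter> ?S \<times> ?S) + card (E \<inter> ?S \<times> hubs))
      + (card (E \<inter> hubs \<times> ?S) + card (E \<inter> hubs \<times> hubs))" .
  moreover have "card (E \<inter> hubs \<times> ?S) = card (E \<inter> ?S \<times> hubs)" by (rule card_Int_Times_sym[OF sym])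
  moreover have "card (E \<inter> hubs \<times> hubs) \<le> \<rho> * card hubs"
    using sparse_within hubs_subset unfolding sparse_within_def by blast
  moreover have "\<rho> * (48 * card hubs) \<le> \<rho> * card W"
    using card_hubs_le_48 positive by (intro mult_left_mono) (auto simp: of_nat_mono)
  ultimately show ?thesis using card_edges by (simp only: of_nat_mult of_nat_numeral) linarith
qed

lemma card_attached_ge:
  assumes "\<rho> * card W / 8 \<le> card (E \<inter> (W - hubs) \<times> hubs)"
  shows "card W \<le> 16 * card attached"
proof -
  have "finite attached" "attached \<inter> hubs = {}" "attached \<union> hubs \<subseteq> W"
    using finite_verts hubs_subset unfolding attached_def by auto
  have "card (E \<inter> (W - hubs) \<times> hubs) \<le> card (E \<inter> attached \<times> hubs) + card (W - hubs) * (\<rho> / 16)"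
    unfolding attached_def using finite_verts finite_edges positive
    by (intro card_Int_Times_le_heavy) auto
  also have "card (W - hubs) * (\<rho> / 16) \<le> card W * (\<rho> / 16)"
    using finite_verts positive by (intro mult_right_mono of_nat_mono card_mono) auto
  finally have "\<rho> * card W / 8 \<le> 2 * card (E \<inter> attached \<times> hubs)"
    using assms by (simp add: mult.commute)
  also have "\<dots> = card (E \<inter> attached \<times> hubs) + card (E \<inter> hubs \<times> attached)"
    using card_Int_Times_sym[OF sym, of hubs attached] by simp
  also have "\<dots> = card (E \<inter> attached \<times> hubs \<union> E \<inter> hubs \<times> attached)"
    using finite_edges \<open>attached \<inter> hubs = {}\<close> by (subst card_Un_disjoint) auto
  also have "\<dots> \<le> card (E \<inter> (attached \<union> hubs) \<times> (attached \<union> hubs))"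
    using finite_edges by (intro of_nat_mono card_mono) auto
  also have "\<dots> \<le> \<rho> * card (attached \<union> hubs)"
    using sparse_within \<open>attached \<union> hubs \<subseteq> W\<close> unfolding sparse_within_def by blast
  also have "\<dots> \<le> \<rho> * (card attached + card hubs)"
    using positive by (intro mult_left_mono of_nat_mono card_Un_le) auto
  finally have "\<rho> * card W \<le> \<rho> * (8 * (card attached + card hubs))"
    by (simp add: algebra_simps)
  then have "real (card W) \<le> real (8 * (card attached + card hubs))"
    using positive by (simp only: mult_le_cancel_left_pos)
  then have "card W \<le> 8 * card attached + 8 * card hubs"
    by (simp add: algebra_simps flip: of_nat_le_iff)
  then show ?thesis using card_hubs_le_48 by linarith
qed

lemma hub_contraction:
  assumes many_edges: "\<rho> * card W / 8 \<le> card (E \<inter> (W - hubs) \<times> hubs)"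
    and sparse: "sparse_upto E N \<delta>" and "1 \<le> \<delta>" "1 \<le> K" "\<Lambda> = 16 * (real K + 2)"
    and \<rho>_large: "8192 * \<Lambda>\<^sup>2 * \<delta> \<le> \<rho>" and "3 * (\<Lambda> * \<rho>) \<le> N"
  shows "dense_contraction E W (1 + real K) (K * \<rho> / 128)"
proof -
  have "0 < \<rho> * card W / 8" using positive card_W_pos by simp
  then have "hubs \<noteq> {}" using many_edges by auto
  have "finite attached" "attached \<subseteq> W" "attached \<inter> hubs = {}"
    using finite_verts unfolding attached_def by auto
  have cluster_rel_hubs: "cluster_rel E (\<lambda>y. {y}) hubs `` {x} = E `` {x} \<inter> hubs" for x
    unfolding cluster_rel_def by auto
  have "dense_contraction E W (1 + real K) (K * (\<rho> / 16) / 8)"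
  proof (rule star_contraction[OF finite_edges sym sparse clustering_singletons,
        where X = attached])
    show "\<rho> / 16 \<le> card (cluster_rel E (\<lambda>y. {y}) hubs `` {x})" if "x \<in> attached" for x
      using that unfolding cluster_rel_hubs attached_def by simp
    show "real (card (E `` {x})) * 1 \<le> \<Lambda> * \<rho>" if "x \<in> attached" for x
      using that unfolding attached_def hubs_def by auto
    have "card hubs * \<Lambda> \<le> 16 * card attached"
      using card_hubs_le card_attached_ge[OF many_edges] by linarith
    then have "real ((K + 2) * card hubs) \<le> card attached"
      unfolding \<open>\<Lambda> = 16 * (real K + 2)\<close> by (simp add: algebra_simps)
    then have "(K + 2) * card hubs \<le> card attached" by (simp only: of_nat_le_iff)
    moreover have "0 < card hubs" using \<open>hubs \<noteq> {}\<close> finite_hubs by (simp add: card_gt_0_iff)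
    ultimately show "(K + 1) * card hubs < card attached" by simp
    have "K \<le> \<Lambda>" using \<open>\<Lambda> = 16 * (real K + 2)\<close> by simp
    then have "8192 * (K * \<Lambda>) * \<delta> \<le> 8192 * \<Lambda>\<^sup>2 * \<delta>"
      using \<open>1 \<le> \<delta>\<close> threshold unfolding power2_eq_square
      by (intro mult_right_mono mult_left_mono) auto
    then have \<rho>_ge: "8192 * (K * \<Lambda>) * \<delta> \<le> \<rho>" using \<rho>_large by linarith
    then have "8192 * (K * \<Lambda>) * \<delta> * \<rho> \<le> \<rho> * \<rho>" using positive by (intro mult_right_mono) auto
    then show "32 * K * (\<Lambda> * \<rho>) * \<delta> \<le> (\<rho> / 16)\<^sup>2" by (simp add: power2_eq_square field_simps)
    have "K * \<delta> * 1 \<le> K * \<delta> * \<Lambda>" using threshold \<open>1 \<le> \<delta>\<close> by (intro mult_left_mono) auto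
    then have "8192 * (K * \<delta>) \<le> \<rho>" using \<rho>_ge by (simp add: mult_ac)
    moreover have "1 * 1 \<le> K * \<delta>" using \<open>1 \<le> K\<close> \<open>1 \<le> \<delta>\<close> by (intro mult_mono) auto
    ultimately show "8 * K * \<delta> \<le> \<rho> / 16" "4 \<le> \<rho> / 16" by linarith+
  qed (use assms hubs_subset finite_hubs \<open>hubs \<noteq> {}\<close> \<open>finite attached\<close> \<open>attached \<subseteq> W\<close>
      \<open>attached \<inter> hubs = {}\<close> in auto)
  then show ?thesis by simp
qed

lemma low_degree_contraction:
  assumes many_edges: "\<rho> * card W / 2 \<le> card (E \<inter> (W - hubs) \<times> (W - hubs))"
    and sparse: "sparse_upto E N \<delta>" and "1 \<le> \<delta>" "1 \<le> K"
    and "16 * (4 * \<Lambda>) ^ 3 * (real K + 2) \<le> L"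
    and "32768 * ((4 * \<Lambda>)\<^sup>2 * (real L + 1)\<^sup>2) * \<delta> \<le> \<rho>" "3 * (\<Lambda> * \<rho> * (real L + 1)) \<le> N"
  shows "dense_contraction E W (real L + 1 + K) (K * \<rho> / (2048 * \<Lambda>))"
proof -
  define S where "S = W - hubs"
  define E' where "E' = E \<inter> S \<times> S"
  have "E' \<subseteq> E" "S \<subseteq> W" unfolding E'_def S_def by auto
  have "0 < \<rho> * card W / 2" using positive card_W_pos by simp
  have "dense_contraction E' S (real L + 1 + K) (K * (\<rho> / 4) / (128 * (4 * \<Lambda>)))"
  proof (rule bounded_degree_contraction[where P = P])
    show "finite S" unfolding S_def using finite_verts by simp
    show "S \<noteq> {}" using many_edges \<open>0 < \<rho> * card W / 2\<close> unfolding S_def by force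
    show "E' \<subseteq> S \<times> S" "E' \<subseteq> crossing P" "sym E'"
      using edges_between sym unfolding E'_def sym_def by auto
    show "sparse_upto E' N \<delta>" using sparse \<open>E' \<subseteq> E\<close> finite_edges by (rule sparse_upto_mono)
    have "card S \<le> card W" using \<open>S \<subseteq> W\<close> finite_verts by (rule card_mono[rotated])
    then have "\<rho> / 2 * card S \<le> \<rho> / 2 * card W" using positive by (intro mult_left_mono) auto
    then show "2 * (\<rho> / 4) * card S \<le> card E'" using many_edges unfolding E'_def S_def by simp
    fix v assume "v \<in> S"
    then have "card (E `` {v}) \<le> \<Lambda> * \<rho>" unfolding S_def hubs_def by auto
    moreover have "card (E' `` {v}) \<le> card (E `` {v})"
      using \<open>E' \<subseteq> E\<close> finite_edges by (intro card_mono) (auto simp: finite_Image)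
    ultimately show "card (E' `` {v}) \<le> 4 * \<Lambda> * (\<rho> / 4)" by simp
  qed (use assms threshold in auto)
  then show ?thesis using \<open>E' \<subseteq> E\<close> \<open>S \<subseteq> W\<close> by (rule dense_contraction_mono) simp
qed

end

text \<open>The constants are chosen such that the density gains a factor of at least \<open>g powr (1 - \<epsilon>)\<close> in
  either kind of contraction, where \<open>g\<close> bounds the size of the clusters.\<close>

definition hub_leaves :: "real \<Rightarrow> nat" where
  "hub_leaves \<epsilon> = nat \<lceil>512 powr (1 / \<epsilon>)\<rceil>"

definition hub_threshold :: "real \<Rightarrow> nat" where
  "hub_threshold \<epsilon> = 16 * (hub_leaves \<epsilon> + 2)"

definition attached_leaves :: "real \<Rightarrow> nat" where
  "attached_leaves \<epsilon> = nat \<lceil>(51200 * real (4 * hub_threshold \<epsilon>) ^ 4) powr (1 / \<epsilon>)\<rceil>"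

definition packing_leaves :: "real \<Rightarrow> nat" where
  "packing_leaves \<epsilon> = 16 * (4 * hub_threshold \<epsilon>) ^ 3 * (attached_leaves \<epsilon> + 2)"

definition round_cost :: "real \<Rightarrow> real" where
  "round_cost \<epsilon> = 65536 * ((4 * hub_threshold \<epsilon>)\<^sup>2 * (real (packing_leaves \<epsilon>) + 1)\<^sup>2)"

lemma nat_ceiling_root_powr_ge:
  fixes c \<epsilon> :: real
  assumes "0 < \<epsilon>" "0 < c"
  shows "1 \<le> nat \<lceil>c powr (1 / \<epsilon>)\<rceil>" "c \<le> nat \<lceil>c powr (1 / \<epsilon>)\<rceil> powr \<epsilon>"
proof -
  have "0 < c powr (1 / \<epsilon>)" using assms(2) by simp
  then show "1 \<le> nat \<lceil>c powr (1 / \<epsilon>)\<rceil>" by linarith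
  have "c = (c powr (1 / \<epsilon>)) powr \<epsilon>" using assms by (simp add: powr_powr)
  also have "\<dots> \<le> nat \<lceil>c powr (1 / \<epsilon>)\<rceil> powr \<epsilon>"
    using assms(1) by (intro powr_mono2 real_nat_ceiling_ge) auto
  finally show "c \<le> nat \<lceil>c powr (1 / \<epsilon>)\<rceil> powr \<epsilon>" .
qed

lemma powr_one_minus_le_divide:
  fixes b c K \<epsilon> :: real
  assumes "0 < \<epsilon>" "1 \<le> b" "0 < c" "0 < K" "c \<le> K powr \<epsilon>"
  shows "(b * K) powr (1 - \<epsilon>) \<le> b * K / c"
proof -
  have "(b * K) powr (1 - \<epsilon>) = b powr (1 - \<epsilon>) * K powr (1 - \<epsilon>)"
    using assms by (simp add: powr_mult)
  also have "\<dots> \<le> b * K powr (1 - \<epsilon>)"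
    using assms powr_mono[of "1 - \<epsilon>" 1 b] by (intro mult_right_mono) auto
  also have "K powr (1 - \<epsilon>) = K / K powr \<epsilon>" using assms by (simp add: powr_diff)
  also have "b * (K / K powr \<epsilon>) \<le> b * (K / c)"
    using assms by (intro mult_left_mono divide_left_mono) auto
  finally show ?thesis by simp
qed

lemma hub_gain:
  assumes "0 < \<epsilon>" "\<epsilon> < 1"
  shows "(1 + real (hub_leaves \<epsilon>)) powr (1 - \<epsilon>) \<le> hub_leaves \<epsilon> / 256"
proof -
  let ?K = "real (hub_leaves \<epsilon>)"
  have K: "1 \<le> ?K" "512 \<le> ?K powr \<epsilon>"
    using nat_ceiling_root_powr_ge[of \<epsilon> 512] assms(1) unfolding hub_leaves_def by simp_all
  then have "(1 + ?K) powr (1 - \<epsilon>) \<le> (2 * ?K) powr (1 - \<epsilon>)"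
    using assms(2) by (intro powr_mono2) auto
  also have "\<dots> \<le> 2 * ?K / 512" using K assms by (intro powr_one_minus_le_divide) auto
  finally show ?thesis by simp
qed

lemma packing_gain:
  assumes "0 < \<epsilon>" "\<epsilon> < 1"
  shows "(real (packing_leaves \<epsilon>) + 1 + attached_leaves \<epsilon>) powr (1 - \<epsilon>)
    \<le> attached_leaves \<epsilon> / (4096 * hub_threshold \<epsilon>)"
proof -
  let ?K = "real (attached_leaves \<epsilon>)"
  define \<Gamma> where "\<Gamma> = real (4 * hub_threshold \<epsilon>)"
  have "1 \<le> \<Gamma>" unfolding \<Gamma>_def hub_threshold_def by simp
  then have K: "1 \<le> ?K" "51200 * \<Gamma> ^ 4 \<le> ?K powr \<epsilon>"
    using nat_ceiling_root_powr_ge[of \<epsilon> "51200 * \<Gamma> ^ 4"] assms(1)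
    unfolding attached_leaves_def \<Gamma>_def by simp_all
  have "1 \<le> \<Gamma> ^ 3" using \<open>1 \<le> \<Gamma>\<close> by simp
  then have "1 * ?K \<le> \<Gamma> ^ 3 * ?K" by (intro mult_right_mono) auto
  moreover have "\<Gamma> ^ 3 * 1 \<le> \<Gamma> ^ 3 * ?K" using K(1) \<open>1 \<le> \<Gamma>\<close> by (intro mult_left_mono) auto
  moreover have "packing_leaves \<epsilon> = 16 * (\<Gamma> ^ 3 * ?K) + 32 * \<Gamma> ^ 3"
    unfolding packing_leaves_def \<Gamma>_def by (simp add: algebra_simps)
  ultimately have "packing_leaves \<epsilon> + 1 + ?K \<le> 50 * \<Gamma> ^ 3 * ?K" using K(1) by linarith
  then have "(packing_leaves \<epsilon> + 1 + ?K) powr (1 - \<epsilon>) \<le> (50 * \<Gamma> ^ 3 * ?K) powr (1 - \<epsilon>)"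
    using assms(2) by (intro powr_mono2) auto
  also have "\<dots> \<le> 50 * \<Gamma> ^ 3 * ?K / (51200 * \<Gamma> ^ 4)"
  proof (rule powr_one_minus_le_divide)
    show "1 \<le> 50 * \<Gamma> ^ 3" using \<open>1 \<le> \<Gamma> ^ 3\<close> by linarith
  qed (use assms K \<open>1 \<le> \<Gamma>\<close> in auto)
  also have "\<dots> = ?K / (1024 * \<Gamma>)"
    using \<open>1 \<le> \<Gamma>\<close> by (simp add: field_simps power3_eq_cube power4_eq_xxxx)
  finally show ?thesis unfolding \<Gamma>_def by (simp add: add.commute)
qed

lemma ex_densest_bipartite:
  fixes E :: "('v \<times> 'v) set" and \<rho> D \<Lambda> :: real
  assumes "finite V" "V \<noteq> {}" "E \<subseteq> V \<times> V" "sym E" "irrefl E" "0 < \<rho>" "\<rho> * card V \<le> card E"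
    and "sparse_within E V D" "48 \<le> \<Lambda>"
  obtains E' W P \<rho>' where "E' \<subseteq> E" "W \<subseteq> V" "densest_bipartite E' W P \<rho>' \<Lambda>" "\<rho> / 2 \<le> \<rho>'" "\<rho>' \<le> D"
proof -
  obtain P where P: "card E \<le> 2 * card (E \<inter> crossing P)"
    using ex_half_cut[OF assms(1,3,4,5)] by blast
  obtain W and \<rho>' :: real where W: "W \<subseteq> V" "W \<noteq> {}"
    and densest: "card (E \<inter> crossing P \<inter> W \<times> W) = \<rho>' * card W"
    and within: "sparse_within (E \<inter> crossing P) V \<rho>'"
    using ex_densest_subset[OF assms(1,2), of "E \<inter> crossing P"] .
  define E' where "E' = E \<inter> crossing P \<inter> W \<times> W"
  have "finite E" using assms(1,3) by (meson finite_SigmaI finite_subset)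
  have "finite W" using W(1) assms(1) by (rule finite_subset)
  have "E \<inter> crossing P \<inter> V \<times> V = E \<inter> crossing P" using assms(3) by blast
  then have "card (E \<inter> crossing P) \<le> \<rho>' * card V"
    using within unfolding sparse_within_def by (metis order_refl)
  then have "\<rho> / 2 * card V \<le> \<rho>' * card V" using P assms(7) by simp
  then have low: "\<rho> / 2 \<le> \<rho>'" using assms(1,2) by (simp add: card_gt_0_iff)
  have "card E' \<le> card (E \<inter> W \<times> W)"
    using \<open>finite E\<close> unfolding E'_def by (intro card_mono) auto
  also have "\<dots> \<le> D * card W" using assms(8) W(1) unfolding sparse_within_def by blast
  finally have "\<rho>' * card W \<le> D * card W" using densest unfolding E'_def by simp
  then have up: "\<rho>' \<le> D" using W(2) \<open>finite W\<close> by (simp add: card_gt_0_iff)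
  have "densest_bipartite E' W P \<rho>' \<Lambda>"
  proof
    show "sym E'" using assms(4) unfolding E'_def crossing_def sym_def by auto
    have "E' \<inter> S \<times> S = E \<inter> crossing P \<inter> S \<times> S" if "S \<subseteq> W" for S using that unfolding E'_def by auto
    then show "sparse_within E' W \<rho>'"
      using within W(1) unfolding sparse_within_def by (metis order_trans)
  qed (use W(2) \<open>finite W\<close> densest low assms(6,9) in \<open>auto simp: E'_def\<close>)
  then show thesis using that[of E' W P \<rho>'] W(1) low up unfolding E'_def by blast
qed

lemma round_cost_bounds:
  assumes "0 < \<epsilon>"
  shows "48 \<le> hub_threshold \<epsilon>" "65536 \<le> round_cost \<epsilon>"
    "32768 * (real (hub_threshold \<epsilon>))\<^sup>2 \<le> round_cost \<epsilon>"
    "3 * (hub_threshold \<epsilon> * (real (packing_leaves \<epsilon>) + 1)) \<le> round_cost \<epsilon>"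
proof -
  define \<Lambda> where "\<Lambda> = real (hub_threshold \<epsilon>)"
  define L where "L = real (packing_leaves \<epsilon>)"
  define B where "B = (4 * \<Lambda>)\<^sup>2 * (L + 1)\<^sup>2"
  show "48 \<le> hub_threshold \<epsilon>"
    using nat_ceiling_root_powr_ge(1)[of \<epsilon> 512] assms
    unfolding hub_threshold_def hub_leaves_def by simp
  then have "48 \<le> \<Lambda>" "0 \<le> L" unfolding \<Lambda>_def L_def by simp_all
  then have "1 * 1 \<le> B" "\<Lambda>\<^sup>2 * 1 \<le> B" "\<Lambda> * (L + 1) \<le> B"
    unfolding B_def
    by (intro mult_mono one_le_power power_mono self_le_power; simp add: power2_eq_square)+
  moreover have "round_cost \<epsilon> = 65536 * B" unfolding round_cost_def B_def \<Lambda>_def L_def by simp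
  moreover have "0 \<le> \<Lambda>\<^sup>2" "0 \<le> \<Lambda> * (L + 1)" using \<open>48 \<le> \<Lambda>\<close> \<open>0 \<le> L\<close> by simp_all
  ultimately show "65536 \<le> round_cost \<epsilon>" "32768 * (real (hub_threshold \<epsilon>))\<^sup>2 \<le> round_cost \<epsilon>"
    "3 * (hub_threshold \<epsilon> * (real (packing_leaves \<epsilon>) + 1)) \<le> round_cost \<epsilon>"
    unfolding \<Lambda>_def[symmetric] L_def[symmetric] by linarith+
qed

lemma hub_leaves_pos: "0 < \<epsilon> \<Longrightarrow> 1 \<le> hub_leaves \<epsilon>"
  unfolding hub_leaves_def by (rule nat_ceiling_root_powr_ge) simp_all

lemma attached_leaves_pos:
  assumes "0 < \<epsilon>"
  shows "1 \<le> attached_leaves \<epsilon>"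
  unfolding attached_leaves_def
  using round_cost_bounds(1)[OF assms] by (intro nat_ceiling_root_powr_ge assms) simp

context densest_bipartite
begin

lemma hub_round:
  assumes \<epsilon>: "0 < \<epsilon>" "\<epsilon> < 1" and \<Lambda>: "\<Lambda> = hub_threshold \<epsilon>"
    and many_edges: "\<rho> * card W / 8 \<le> card (E \<inter> (W - hubs) \<times> hubs)"
    and sparse: "sparse_upto E N \<delta>" and "1 \<le> \<delta>"
    and \<rho>_large: "round_cost \<epsilon> * \<delta> \<le> 2 * \<rho>" and N_large: "round_cost \<epsilon> * \<rho> \<le> N"
  shows "\<exists>g\<ge>2. dense_contraction E W g (2 * \<rho> * g powr (1 - \<epsilon>))"
proof -
  let ?K = "hub_leaves \<epsilon>"
  have K: "1 \<le> ?K" by (rule hub_leaves_pos[OF \<epsilon>(1)])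
  have dense: "dense_contraction E W (1 + real ?K) (?K * \<rho> / 128)"
  proof (rule hub_contraction[OF many_edges sparse \<open>1 \<le> \<delta>\<close> K])
    show "\<Lambda> = 16 * (real ?K + 2)" unfolding \<Lambda> hub_threshold_def by simp
    have "32768 * \<Lambda>\<^sup>2 * \<delta> \<le> round_cost \<epsilon> * \<delta>"
      using round_cost_bounds(3)[OF \<epsilon>(1)] \<open>1 \<le> \<delta>\<close> unfolding \<Lambda> by (intro mult_right_mono) auto
    moreover have "0 \<le> \<Lambda>\<^sup>2 * \<delta>" using \<open>1 \<le> \<delta>\<close> by simp
    ultimately show "8192 * \<Lambda>\<^sup>2 * \<delta> \<le> \<rho>" using \<rho>_large by linarith
    have "\<Lambda> * 1 \<le> \<Lambda> * (real (packing_leaves \<epsilon>) + 1)"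
      using threshold by (intro mult_left_mono) auto
    then have "3 * \<Lambda> \<le> round_cost \<epsilon>" using round_cost_bounds(4)[OF \<epsilon>(1)] unfolding \<Lambda> by linarith
    then have "3 * \<Lambda> * \<rho> \<le> round_cost \<epsilon> * \<rho>" using positive by (intro mult_right_mono) auto
    then show "3 * (\<Lambda> * \<rho>) \<le> N" using N_large by simp
  qed
  have "2 * \<rho> * (1 + real ?K) powr (1 - \<epsilon>) \<le> 2 * \<rho> * (?K / 256)"
    using hub_gain[OF \<epsilon>] positive by (intro mult_left_mono) auto
  then have "2 * \<rho> * (1 + real ?K) powr (1 - \<epsilon>) \<le> ?K * \<rho> / 128" by (simp add: mult.commute)
  from dense_contraction_mono[OF dense order_refl order_refl this]
  show ?thesis using K by (intro exI[of _ "1 + real ?K"]) simp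
qed

lemma low_degree_round:
  assumes \<epsilon>: "0 < \<epsilon>" "\<epsilon> < 1" and \<Lambda>: "\<Lambda> = hub_threshold \<epsilon>"
    and many_edges: "\<rho> * card W / 2 \<le> card (E \<inter> (W - hubs) \<times> (W - hubs))"
    and sparse: "sparse_upto E N \<delta>" and "1 \<le> \<delta>"
    and \<rho>_large: "round_cost \<epsilon> * \<delta> \<le> 2 * \<rho>" and N_large: "round_cost \<epsilon> * \<rho> \<le> N"
  shows "\<exists>g\<ge>2. dense_contraction E W g (2 * \<rho> * g powr (1 - \<epsilon>))"
proof -
  let ?K = "attached_leaves \<epsilon>" and ?g = "real (packing_leaves \<epsilon>) + 1 + attached_leaves \<epsilon>"
  have K: "1 \<le> ?K" by (rule attached_leaves_pos[OF \<epsilon>(1)])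
  have dense: "dense_contraction E W ?g (?K * \<rho> / (2048 * \<Lambda>))"
  proof (rule low_degree_contraction[OF many_edges sparse \<open>1 \<le> \<delta>\<close> K])
    show "16 * (4 * \<Lambda>) ^ 3 * (real ?K + 2) \<le> packing_leaves \<epsilon>"
      unfolding \<Lambda> packing_leaves_def by (simp add: algebra_simps)
    show "32768 * ((4 * \<Lambda>)\<^sup>2 * (real (packing_leaves \<epsilon>) + 1)\<^sup>2) * \<delta> \<le> \<rho>"
      using \<rho>_large unfolding \<Lambda> round_cost_def by (simp add: mult_ac)
    have "3 * (\<Lambda> * (real (packing_leaves \<epsilon>) + 1)) * \<rho> \<le> round_cost \<epsilon> * \<rho>"
      using round_cost_bounds(4)[OF \<epsilon>(1)] positive unfolding \<Lambda> by (intro mult_right_mono) auto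
    then show "3 * (\<Lambda> * \<rho> * (real (packing_leaves \<epsilon>) + 1)) \<le> N"
      using N_large by (simp add: mult_ac)
  qed
  have "2 * \<rho> * ?g powr (1 - \<epsilon>) \<le> 2 * \<rho> * (?K / (4096 * \<Lambda>))"
    unfolding \<Lambda> using packing_gain[OF \<epsilon>] positive by (intro mult_left_mono) auto
  then have "2 * \<rho> * ?g powr (1 - \<epsilon>) \<le> ?K * \<rho> / (2048 * \<Lambda>)" by (simp add: mult.commute)
  from dense_contraction_mono[OF dense order_refl order_refl this]
  show ?thesis using K by (intro exI[of _ ?g]) simp
qed

end

lemma contraction_round:
  fixes E :: "('v \<times> 'v) set" and \<rho> \<delta> N D \<epsilon> :: real
  assumes \<epsilon>: "0 < \<epsilon>" "\<epsilon> < 1"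
    and "finite V" "V \<noteq> {}" "E \<subseteq> V \<times> V" "sym E" "irrefl E" "\<rho> * card V \<le> card E"
    and sparse: "sparse_upto E N \<delta>" "sparse_within E V D" and "1 \<le> \<delta>"
    and \<rho>_large: "round_cost \<epsilon> * \<delta> \<le> \<rho>" and N_large: "round_cost \<epsilon> * D \<le> N"
  shows "\<exists>g\<ge>2. dense_contraction E V g (\<rho> * g powr (1 - \<epsilon>))"
proof -
  have "0 < round_cost \<epsilon>" using round_cost_bounds(2)[OF \<epsilon>(1)] by linarith
  then have "0 < round_cost \<epsilon> * \<delta>" using \<open>1 \<le> \<delta>\<close> by simp
  then have "0 < \<rho>" using \<rho>_large by linarith
  have "48 \<le> real (hub_threshold \<epsilon>)" using round_cost_bounds(1)[OF \<epsilon>(1)] by simp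
  then obtain E' W P \<rho>' where E': "E' \<subseteq> E" "W \<subseteq> V" "densest_bipartite E' W P \<rho>' (hub_threshold \<epsilon>)"
    and \<rho>': "\<rho> / 2 \<le> \<rho>'" "\<rho>' \<le> D"
    using ex_densest_bipartite[OF assms(3-7) \<open>0 < \<rho>\<close> assms(8) sparse(2)] by metis
  interpret densest_bipartite E' W P \<rho>' "hub_threshold \<epsilon>" by (rule E'(3))
  have "finite E" using assms(3,5) by (meson finite_SigmaI finite_subset)
  then have sparse': "sparse_upto E' N \<delta>" using sparse_upto_mono[OF sparse(1) E'(1)] by blast
  have \<rho>'_large: "round_cost \<epsilon> * \<delta> \<le> 2 * \<rho>'" using \<rho>_large \<rho>'(1) by linarith
  have "round_cost \<epsilon> * \<rho>' \<le> round_cost \<epsilon> * D" using \<rho>'(2) \<open>0 < round_cost \<epsilon>\<close> by simp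
  then have N_large': "round_cost \<epsilon> * \<rho>' \<le> N" using N_large by linarith
  have "\<exists>g\<ge>2. dense_contraction E' W g (2 * \<rho>' * g powr (1 - \<epsilon>))"
    using many_hub_edges_or_low_degree_edges
      hub_round[OF \<epsilon> refl _ sparse' \<open>1 \<le> \<delta>\<close> \<rho>'_large N_large']
      low_degree_round[OF \<epsilon> refl _ sparse' \<open>1 \<le> \<delta>\<close> \<rho>'_large N_large'] by blast
  then obtain g where "2 \<le> g" and g: "dense_contraction E' W g (2 * \<rho>' * g powr (1 - \<epsilon>))" by blast
  have "\<rho> * g powr (1 - \<epsilon>) \<le> 2 * \<rho>' * g powr (1 - \<epsilon>)" using \<rho>'(1) by (intro mult_right_mono) auto
  then have "dense_contraction E V g (\<rho> * g powr (1 - \<epsilon>))"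
    by (rule dense_contraction_mono[OF g E'(1,2)])
  then show ?thesis using \<open>2 \<le> g\<close> by blast
qed

section \<open>Iterated contraction\<close>

locale contraction_process =
  fixes E :: "('v \<times> 'v) set" and V :: "'v set" and \<rho> \<delta> N D T \<epsilon> :: real
  assumes \<epsilon>: "0 < \<epsilon>" "\<epsilon> < 1"
    and verts: "finite V" "V \<noteq> {}"
    and edges: "E \<subseteq> V \<times> V" "sym E" "irrefl E"
    and dense: "\<rho> * card V \<le> card E"
    and sparse: "sparse_upto E N \<delta>"
    and bounds: "1 \<le> \<delta>" "0 \<le> D" "1 \<le> T"
    and \<rho>_large: "round_cost \<epsilon> * \<delta> * T powr \<epsilon> \<le> \<rho>"
    and N_large: "round_cost \<epsilon> * D * T \<le> N"
    and target: "D \<le> \<rho> * T powr (1 - \<epsilon>)"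
begin

definition reaches :: "real \<Rightarrow> bool" where
  "reaches M \<longleftrightarrow> 1 \<le> M \<and> dense_contraction E V M (\<rho> * M powr (1 - \<epsilon>))"

lemma round_cost_nonneg: "0 \<le> round_cost \<epsilon>"
  unfolding round_cost_def by simp

lemma finite_edges: "finite E"
  using edges(1) verts(1) by (meson finite_SigmaI finite_subset)

lemma reaches_1: "reaches 1"
proof -
  have "clustering E V (\<lambda>x. {x}) V 1" using verts by (intro clustering_singletons) auto
  moreover have "quotient_rel E (\<lambda>x. {x}) V = E"
    using edges quotient_rel_singletons[of E V] by blast
  ultimately show ?thesis
    unfolding reaches_def dense_contraction_def using dense
    by (intro conjI exI[of _ "\<lambda>x. {x}"] exI[of _ V]) auto
qed

lemma sparse_within_quotient_rel:
  fixes U :: "'v set"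
  assumes "clustering E V C U M" "\<nexists>g. dense_contraction E V g D"
  shows "sparse_within (quotient_rel E C U) U D"
  unfolding sparse_within_def
proof (intro allI impI)
  fix S :: "'v set" assume "S \<subseteq> U"
  show "real (card (quotient_rel E C U \<inter> S \<times> S)) \<le> D * real (card S)"
  proof (cases "S = {}")
    case False
    have "quotient_rel E C U \<inter> S \<times> S = quotient_rel E C S"
      using \<open>S \<subseteq> U\<close> unfolding quotient_rel_def by auto
    moreover have "\<not> D * card S \<le> card (quotient_rel E C S)"
      using clustering_restrict[OF assms(1) \<open>S \<subseteq> U\<close> False] assms(2)
      unfolding dense_contraction_def by blast
    ultimately show ?thesis by simp
  qed simp
qed

lemma reaches_double:
  assumes M: "reaches M" "M < T" and "\<nexists>g. dense_contraction E V g D"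
  shows "\<exists>M'\<ge>2 * M. reaches M'"
proof -
  have "1 \<le> M" using M(1) unfolding reaches_def by blast
  obtain C and U :: "'v set" where C: "clustering E V C U M"
    and dense_U: "\<rho> * M powr (1 - \<epsilon>) * card U \<le> card (quotient_rel E C U)"
    using M(1) unfolding reaches_def dense_contraction_def by blast
  interpret clustering E V C U M by (rule C)
  have "\<exists>g\<ge>2. dense_contraction (quotient_rel E C U) U g (\<rho> * M powr (1 - \<epsilon>) * g powr (1 - \<epsilon>))"
  proof (rule contraction_round[OF \<epsilon> finite_index index_nonempty])
    show "sparse_upto (quotient_rel E C U) (N / M) (M * \<delta>)"
      using bounds(1) by (intro sparse_upto_quotient_rel finite_edges sparse) simp
    show "sparse_within (quotient_rel E C U) U D"
      using C assms(3) by (rule sparse_within_quotient_rel)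
    show "1 \<le> M * \<delta>" using \<open>1 \<le> M\<close> bounds(1) mult_mono[of 1 M 1 \<delta>] by simp
    have "round_cost \<epsilon> * (M * \<delta>) = (round_cost \<epsilon> * \<delta> * M powr \<epsilon>) * M powr (1 - \<epsilon>)"
      using \<open>1 \<le> M\<close> by (simp flip: powr_add)
    also have "\<dots> \<le> (round_cost \<epsilon> * \<delta> * T powr \<epsilon>) * M powr (1 - \<epsilon>)"
      using \<open>1 \<le> M\<close> M(2) \<epsilon>(1) bounds(1) round_cost_nonneg
      by (intro mult_right_mono mult_left_mono powr_mono2) auto
    also have "\<dots> \<le> \<rho> * M powr (1 - \<epsilon>)" using \<rho>_large by (intro mult_right_mono) auto
    finally show "round_cost \<epsilon> * (M * \<delta>) \<le> \<rho> * M powr (1 - \<epsilon>)" .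
    have "round_cost \<epsilon> * D * M \<le> round_cost \<epsilon> * D * T"
      using M(2) bounds(2) round_cost_nonneg by (intro mult_left_mono) auto
    then show "round_cost \<epsilon> * D \<le> N / M" using N_large \<open>1 \<le> M\<close> by (simp add: le_divide_eq)
  qed (use dense_U quotient_rel_subset irrefl_quotient_rel sym_quotient_rel[OF edges(2)] in auto)
  then obtain g where "2 \<le> g"
    and g: "dense_contraction (quotient_rel E C U) U g (\<rho> * M powr (1 - \<epsilon>) * g powr (1 - \<epsilon>))"
    by blast
  have "dense_contraction E V (M * g) (\<rho> * M powr (1 - \<epsilon>) * g powr (1 - \<epsilon>))"
    using C g by (rule dense_contraction_compose)
  moreover have "\<rho> * M powr (1 - \<epsilon>) * g powr (1 - \<epsilon>) = \<rho> * (M * g) powr (1 - \<epsilon>)"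
    using \<open>1 \<le> M\<close> \<open>2 \<le> g\<close> by (simp add: powr_mult)
  moreover have "1 \<le> M * g" "2 * M \<le> M * g" using \<open>1 \<le> M\<close> \<open>2 \<le> g\<close> mult_mono[of 1 M 1 g] by auto
  ultimately show ?thesis unfolding reaches_def by auto
qed

lemma ex_dense_contraction: "\<exists>g. dense_contraction E V g D"
proof (rule ccontr)
  assume none: "\<nexists>g. dense_contraction E V g D"
  have "\<exists>M. reaches M \<and> (T \<le> M \<or> 2 ^ k \<le> M)" for k :: nat
  proof (induction k)
    case 0
    then show ?case using reaches_1 by auto
  next
    case (Suc k)
    then obtain M where M: "reaches M" "T \<le> M \<or> 2 ^ k \<le> M" by blast
    show ?case
    proof (cases "T \<le> M")
      case False
      then obtain M' where "2 * M \<le> M'" "reaches M'" using reaches_double[OF M(1) _ none] by auto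
      then show ?thesis using M(2) False by (intro exI[of _ M']) auto
    qed (use M in blast)
  qed
  moreover obtain k :: nat where "T < 2 ^ k" using real_arch_pow[of 2 T] by auto
  ultimately obtain M where M: "reaches M" "T \<le> M" by (meson less_imp_le order_trans)
  have "0 \<le> round_cost \<epsilon> * \<delta> * T powr \<epsilon>" using round_cost_nonneg bounds(1) by simp
  then have "0 \<le> \<rho>" using \<rho>_large by linarith
  have "\<rho> * T powr (1 - \<epsilon>) \<le> \<rho> * M powr (1 - \<epsilon>)"
    using \<open>0 \<le> \<rho>\<close> M(2) bounds(3) \<epsilon>(2) by (intro mult_left_mono powr_mono2) auto
  then have "dense_contraction E V M D"
    using M(1) target unfolding reaches_def by (auto intro: dense_contraction_mono)
  then show False using none by blast
qed

end

section \<open>Graphs as symmetric relations\<close>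

definition edge_rel :: "'a ugraph \<Rightarrow> ('a \<times> 'a) set" where
  "edge_rel G = {(u, v). {u, v} \<in> edges G}"

definition graph_of_rel :: "'a set \<Rightarrow> ('a \<times> 'a) set \<Rightarrow> 'a ugraph" where
  "graph_of_rel V R = \<lparr>verts = V, edges = {{x, y} | x y. (x, y) \<in> R}\<rparr>"

lemma simple_graph_edgeE:
  assumes "simple_graph G" "e \<in> edges G"
  obtains u v where "e = {u, v}" "u \<in> verts G" "v \<in> verts G" "u \<noteq> v"
  using assms unfolding simple_graph_def by blast

lemma simple_graph_edge_subset: "\<lbrakk>simple_graph G; e \<in> edges G\<rbrakk> \<Longrightarrow> e \<subseteq> verts G"
  by (erule simple_graph_edgeE) auto

lemma simple_graph_finite_edges: "simple_graph G \<Longrightarrow> finite (edges G)"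
  unfolding simple_graph_def by (rule finite_subset[of _ "Pow (verts G)"]) auto

lemma sym_edge_rel: "sym (edge_rel G)"
  unfolding edge_rel_def sym_def by (simp add: insert_commute)

lemma edge_rel_subset: "simple_graph G \<Longrightarrow> edge_rel G \<subseteq> verts G \<times> verts G"
  unfolding edge_rel_def using simple_graph_edge_subset by fastforce

lemma irrefl_edge_rel: "simple_graph G \<Longrightarrow> irrefl (edge_rel G)"
  unfolding edge_rel_def irrefl_def by (auto elim: simple_graph_edgeE)

lemma card_edge_rel:
  assumes "simple_graph G"
  shows "card (edge_rel G) = 2 * card (edges G)"
proof -
  have card_2: "card {(u, v). {u, v} = e} = 2" if e_in: "e \<in> edges G" for e
  proof -
    obtain a b where e: "e = {a, b}" "a \<noteq> b" using simple_graph_edgeE[OF assms e_in] by metis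
    then have "{(u, v). {u, v} = e} = {(a, b), (b, a)}" by (auto simp: doubleton_eq_iff)
    then show ?thesis using e(2) by simp
  qed
  have "edge_rel G = (\<Union>e\<in>edges G. {(u, v). {u, v} = e})" unfolding edge_rel_def by auto
  also have "card \<dots> = (\<Sum>e\<in>edges G. card {(u, v). {u, v} = e})"
  proof (intro card_UN_disjoint ballI impI)
    show "finite {(u, v). {u, v} = e}" if "e \<in> edges G" for e
      using card_2[OF that] by (intro card_ge_0_finite) simp
  qed (use simple_graph_finite_edges[OF assms] in auto)
  also have "\<dots> = 2 * card (edges G)" using card_2 by simp
  finally show ?thesis .
qed

lemma simple_graph_of_rel:
  assumes "finite V" "R \<subseteq> V \<times> V" "irrefl R"
  shows "simple_graph (graph_of_rel V R)"
  using assms unfolding simple_graph_def graph_of_rel_def irrefl_def by fastforce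

lemma edge_rel_graph_of_rel: "sym R \<Longrightarrow> edge_rel (graph_of_rel V R) = R"
  unfolding edge_rel_def graph_of_rel_def sym_def by (auto simp: doubleton_eq_iff)

lemma is_minor_refl:
  assumes "simple_graph G"
  shows "is_minor G G"
proof -
  have "connected_in G {x}" if "x \<in> verts G" for x using that unfolding connected_in_def by simp
  then show ?thesis
    unfolding is_minor_def disjoint_family_on_def by (intro exI[of _ "\<lambda>x. {x}"]) auto
qed

lemma is_minor_quotient:
  assumes "clustering (edge_rel G) (verts G) C V g"
  shows "is_minor (graph_of_rel V (quotient_rel (edge_rel G) C V)) G"
proof -
  interpret clustering "edge_rel G" "verts G" C V g by fact
  let ?R = "quotient_rel (edge_rel G) C V"
  have "connected_in G (C x)" if "x \<in> V" for x
  proof -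
    have "{(a, b). a \<in> C x \<and> b \<in> C x \<and> {a, b} \<in> edges G} = edge_rel G \<inter> C x \<times> C x"
      unfolding edge_rel_def by auto
    then show ?thesis
      using cluster_subset[OF that] connected_cluster[OF that]
      unfolding connected_in_def connected_rel_def by auto
  qed
  moreover have "\<exists>u\<in>C x. \<exists>v\<in>C y. {u, v} \<in> edges G"
    if "{x, y} \<in> edges (graph_of_rel V ?R)" for x y
  proof -
    have "(x, y) \<in> edge_rel (graph_of_rel V ?R)" using that unfolding edge_rel_def by simp
    then have "(x, y) \<in> ?R" by (simp add: edge_rel_graph_of_rel sym_quotient_rel sym_edge_rel)
    then show ?thesis unfolding quotient_rel_def edge_rel_def by auto
  qed
  ultimately show ?thesis
    using disjoint_clusters unfolding is_minor_def
    by (intro exI[of _ C]) (auto simp: graph_of_rel_def)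
qed

lemma ex_minor_if_dense_contraction:
  fixes G :: "'v ugraph"
  assumes "dense_contraction (edge_rel G) (verts G) g (2 * D)"
  shows "\<exists>J :: 'v ugraph. simple_graph J \<and> is_minor J G \<and> D \<le> graph_density J"
proof -
  obtain C and V :: "'v set" where C: "clustering (edge_rel G) (verts G) C V g"
    and dense: "2 * D * card V \<le> card (quotient_rel (edge_rel G) C V)"
    using assms unfolding dense_contraction_def by blast
  interpret clustering "edge_rel G" "verts G" C V g by (rule C)
  let ?R = "quotient_rel (edge_rel G) C V"
  let ?J = "graph_of_rel V ?R"
  have J: "simple_graph ?J"
    using finite_index quotient_rel_subset irrefl_quotient_rel by (rule simple_graph_of_rel)
  then have "card ?R = 2 * card (edges ?J)"
    using card_edge_rel[OF J] by (simp add: edge_rel_graph_of_rel sym_quotient_rel sym_edge_rel)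
  moreover have "0 < real (card V)"
    using finite_index index_nonempty by (simp add: card_gt_0_iff)
  ultimately have "D \<le> graph_density ?J"
    using dense unfolding graph_density_def by (simp add: graph_of_rel_def le_divide_eq)
  then show ?thesis using J is_minor_quotient[OF C] by blast
qed

section \<open>The Turan number\<close>

definition image_graph :: "('a \<Rightarrow> 'b) \<Rightarrow> 'a ugraph \<Rightarrow> 'b ugraph" where
  "image_graph \<phi> G = \<lparr>verts = \<phi> ` verts G, edges = (\<lambda>e. \<phi> ` e) ` edges G\<rparr>"

lemma simple_image_graph:
  assumes "simple_graph G" "inj_on \<phi> (verts G)"
  shows "simple_graph (image_graph \<phi> G)"
  unfolding simple_graph_def
proof (intro conjI subsetI)
  show "finite (verts (image_graph \<phi> G))"
    using assms(1) unfolding image_graph_def simple_graph_def by simp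
  fix e assume "e \<in> edges (image_graph \<phi> G)"
  then obtain a b where "e = {\<phi> a, \<phi> b}" "a \<in> verts G" "b \<in> verts G" "a \<noteq> b"
    using assms(1) unfolding image_graph_def by (auto elim!: simple_graph_edgeE)
  then show "e \<in> {{u, v} | u v. u \<in> verts (image_graph \<phi> G) \<and> v \<in> verts (image_graph \<phi> G) \<and> u \<noteq> v}"
    using assms(2) unfolding image_graph_def by (auto dest: inj_onD)
qed

lemma edge_image_graph_iff:
  assumes "simple_graph G" "inj_on \<phi> (verts G)" "a \<in> verts G" "b \<in> verts G"
  shows "{\<phi> a, \<phi> b} \<in> edges (image_graph \<phi> G) \<longleftrightarrow> {a, b} \<in> edges G"
proof -
  have "\<phi> ` {a, b} \<in> (`) \<phi> ` edges G \<longleftrightarrow> {a, b} \<in> edges G"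
    using assms simple_graph_edge_subset[OF assms(1)]
    by (intro inj_on_image_mem_iff[OF inj_on_image_Pow[OF assms(2)]]) auto
  then show ?thesis unfolding image_graph_def by simp
qed

lemma isomorphic_image_graph:
  assumes "simple_graph G" "inj_on \<phi> (verts G)" "isomorphic G H"
  shows "isomorphic (image_graph \<phi> G) H"
proof -
  obtain \<psi> where \<psi>: "bij_betw \<psi> (verts G) (verts H)"
    "\<forall>u\<in>verts G. \<forall>v\<in>verts G. {u, v} \<in> edges G \<longleftrightarrow> {\<psi> u, \<psi> v} \<in> edges H"
    using assms(3) unfolding isomorphic_def by blast
  let ?i = "inv_into (verts G) \<phi>"
  have "bij_betw (\<psi> \<circ> ?i) (\<phi> ` verts G) (verts H)"
    using bij_betw_trans[OF bij_betw_inv_into[OF inj_on_imp_bij_betw[OF assms(2)]] \<psi>(1)] .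
  moreover have "{u, v} \<in> edges (image_graph \<phi> G) \<longleftrightarrow> {(\<psi> \<circ> ?i) u, (\<psi> \<circ> ?i) v} \<in> edges H"
    if "u \<in> \<phi> ` verts G" "v \<in> \<phi> ` verts G" for u v
    using that \<psi>(2) assms(2) edge_image_graph_iff[OF assms(1,2)] by auto
  ultimately show ?thesis unfolding isomorphic_def by (auto simp: image_graph_def)
qed

lemma graph_free_if_embeds:
  assumes free: "graph_free H G" and "inj_on \<phi> (verts G')" "\<phi> ` verts G' \<subseteq> verts G"
    and edges: "\<And>e. e \<in> edges G' \<Longrightarrow> \<phi> ` e \<in> edges G"
  shows "graph_free H G'"
  unfolding graph_free_def
proof
  assume "\<exists>K. subgraph K G' \<and> isomorphic K H"
  then obtain K where K: "simple_graph K" "verts K \<subseteq> verts G'" "edges K \<subseteq> edges G'"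
    and iso: "isomorphic K H"
    unfolding subgraph_def by blast
  have inj: "inj_on \<phi> (verts K)" using assms(2) K(2) by (rule inj_on_subset)
  have "subgraph (image_graph \<phi> K) G"
    using simple_image_graph[OF K(1) inj] K(2,3) assms(3) edges
    unfolding subgraph_def image_graph_def by auto
  then show False
    using free isomorphic_image_graph[OF K(1) inj iso] unfolding graph_free_def by blast
qed

lemma graph_free_image_graph:
  assumes "simple_graph G" "graph_free H G" "inj_on \<phi> (verts G)"
  shows "graph_free H (image_graph \<phi> G)"
proof (rule graph_free_if_embeds[OF assms(2)])
  let ?i = "inv_into (verts G) \<phi>"
  show "inj_on ?i (verts (image_graph \<phi> G))" "?i ` verts (image_graph \<phi> G) \<subseteq> verts G"
    using assms(3) unfolding image_graph_def by (auto simp: inj_on_inv_into)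
  show "?i ` e \<in> edges G" if "e \<in> edges (image_graph \<phi> G)" for e
    using that inv_into_image_cancel[OF assms(3) simple_graph_edge_subset[OF assms(1)]]
    unfolding image_graph_def by auto
qed

lemma card_edges_le_turan_number:
  fixes H :: "'h ugraph" and G :: "'b ugraph"
  assumes G: "simple_graph G" "graph_free H G"
  shows "card (edges G) \<le> turan_number (card (verts G)) H"
proof -
  have "finite (verts G)" using G(1) unfolding simple_graph_def by simp
  then obtain \<phi> :: "'b \<Rightarrow> nat" where \<phi>: "inj_on \<phi> (verts G)"
    using finite_imp_inj_to_nat_seg[of "verts G"] by auto
  define sizes where "sizes = {card (edges F) | F :: nat ugraph.
    simple_graph F \<and> card (verts F) = card (verts G) \<and> graph_free H F}"
  have "card (verts (image_graph \<phi> G)) = card (verts G)"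
    using \<phi> unfolding image_graph_def by (simp add: card_image)
  moreover have "card (edges (image_graph \<phi> G)) = card (edges G)"
  proof -
    have "inj_on ((`) \<phi>) (edges G)"
      using inj_on_image_Pow[OF \<phi>] simple_graph_edge_subset[OF G(1)] by (auto intro: inj_on_subset)
    then show ?thesis unfolding image_graph_def by (simp add: card_image)
  qed
  ultimately have "card (edges G) \<in> sizes"
    using simple_image_graph[OF G(1) \<phi>] graph_free_image_graph[OF G \<phi>]
    unfolding sizes_def by (intro CollectI exI[of _ "image_graph \<phi> G"]) simp
  moreover have "bdd_above sizes"
  proof (rule bdd_aboveI)
    fix n assume "n \<in> sizes"
    then obtain F :: "nat ugraph" where F: "n = card (edges F)" "simple_graph F"
      "card (verts F) = card (verts G)"
      unfolding sizes_def by blast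
    have "finite (verts F)" using F(2) unfolding simple_graph_def by simp
    then have "card (edges F) \<le> card (Pow (verts F))"
      using simple_graph_edge_subset[OF F(2)] by (intro card_mono) auto
    then show "n \<le> 2 ^ card (verts G)" using F(1,3) \<open>finite (verts F)\<close> by (simp add: card_Pow)
  qed
  ultimately show ?thesis unfolding turan_number_def sizes_def by (rule cSup_upper)
qed

lemma card_edge_rel_induced_le_turan_number:
  fixes H :: "'h ugraph" and G :: "'b ugraph"
  assumes G: "simple_graph G" "graph_free H G" and "S \<subseteq> verts G"
  shows "card (edge_rel G \<inter> S \<times> S) \<le> 2 * turan_number (card S) H"
proof -
  let ?R = "edge_rel G \<inter> S \<times> S"
  let ?F = "graph_of_rel S ?R"
  have "finite S" using assms(1,3) unfolding simple_graph_def by (blast intro: finite_subset)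
  moreover have "irrefl ?R" using irrefl_edge_rel[OF G(1)] unfolding irrefl_def by blast
  ultimately have F: "simple_graph ?F" by (intro simple_graph_of_rel) auto
  have "graph_free H ?F"
  proof (rule graph_free_if_embeds[OF G(2), of id])
    show "id ` verts ?F \<subseteq> verts G" using assms(3) unfolding graph_of_rel_def by simp
    show "id ` e \<in> edges G" if "e \<in> edges ?F" for e
      using that unfolding graph_of_rel_def edge_rel_def by auto
  qed simp
  then have "card (edges ?F) \<le> turan_number (card S) H"
    using card_edges_le_turan_number[OF F] unfolding graph_of_rel_def by simp
  moreover have "sym ?R" using sym_edge_rel[of G] unfolding sym_def by blast
  ultimately show ?thesis using card_edge_rel[OF F] by (simp add: edge_rel_graph_of_rel)
qed

lemma eventually_turan_number_le:
  assumes "1 < turan_exponent H" "turan_exponent H < p"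
  shows "\<forall>\<^sub>F n in sequentially. turan_number n H \<le> real n powr p"
proof -
  let ?q = "\<lambda>n. ereal (ln (real (turan_number n H)) / ln (real n))"
  have "\<bar>limsup ?q\<bar> \<noteq> \<infinity>"
    using assms(1) unfolding turan_exponent_def by auto
  then have "limsup ?q < ereal p"
    using assms(2) unfolding turan_exponent_def by (simp add: real_less_ereal_iff)
  then have "\<forall>\<^sub>F n in sequentially. ?q n < ereal p" by (rule Limsup_lessD)
  then show ?thesis
    using eventually_ge_at_top[of 2]
  proof eventually_elim
    case (elim n)
    show ?case
    proof (cases "turan_number n H = 0")
      case False
      have "ln (real (turan_number n H)) \<le> p * ln (real n)"
        using elim by (simp add: divide_less_eq less_imp_le)
      then have "exp (ln (real (turan_number n H))) \<le> exp (p * ln (real n))" by simp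
      then show ?thesis using False elim by (simp add: powr_def)
    qed simp
  qed
qed

lemma sparse_upto_edge_rel:
  fixes H :: "'h ugraph" and G :: "'b ugraph"
  assumes G: "simple_graph G" "graph_free H G" and "1 < p"
    and turan: "\<And>n. n \<ge> n0 \<Longrightarrow> turan_number n H \<le> real n powr p"
    and \<delta>: "real n0 \<le> \<delta>" "N powr (p - 1) \<le> \<delta>"
  shows "sparse_upto (edge_rel G) N (2 * \<delta>)"
  unfolding sparse_upto_def
proof (intro allI impI)
  fix S0 :: "'b set" assume S0: "finite S0 \<and> real (card S0) \<le> N"
  define S where "S = S0 \<inter> verts G"
  let ?R = "edge_rel G \<inter> S \<times> S"
  have "finite S" "card S \<le> card S0" unfolding S_def using S0 by (auto intro: card_mono)
  have "0 \<le> \<delta>" using \<delta>(1) by linarith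
  have "edge_rel G \<inter> S0 \<times> S0 = ?R" using edge_rel_subset[OF G(1)] unfolding S_def by auto
  moreover have "card ?R \<le> 2 * \<delta> * card S"
  proof (cases "card S < n0")
    case True
    have "card ?R \<le> card (S \<times> S)" using \<open>finite S\<close> by (intro card_mono) auto
    then have "real (card ?R) \<le> real (card S) * card S"
      by (simp add: card_cartesian_product flip: of_nat_mult)
    also have "\<dots> \<le> (2 * \<delta>) * card S" using True \<delta> \<open>0 \<le> \<delta>\<close> by (intro mult_right_mono) auto
    finally show ?thesis .
  next
    case False
    have "card ?R \<le> 2 * turan_number (card S) H"
      unfolding S_def by (intro card_edge_rel_induced_le_turan_number G) simp
    then have "real (card ?R) \<le> 2 * real (turan_number (card S) H)" by (simp flip: of_nat_le_iff)
    also have "real (turan_number (card S) H) \<le> real (card S) powr p" using turan False by simp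
    also have "real (card S) powr p = real (card S) powr (p - 1) * card S"
      using powr_add[of "card S" "p - 1" 1] by (cases "card S = 0") auto
    also have "\<dots> \<le> N powr (p - 1) * card S"
      using \<open>card S \<le> card S0\<close> S0 \<open>1 < p\<close> by (intro mult_right_mono powr_mono2) auto
    also have "\<dots> \<le> \<delta> * card S" using \<delta>(2) by (intro mult_right_mono) auto
    finally show ?thesis by simp
  qed
  moreover have "2 * \<delta> * card S \<le> 2 * \<delta> * card S0"
    using \<open>card S \<le> card S0\<close> \<open>0 \<le> \<delta>\<close> by (intro mult_left_mono) auto
  ultimately show "real (card (edge_rel G \<inter> S0 \<times> S0)) \<le> 2 * \<delta> * real (card S0)" by simp
qed

section \<open>Dense minors\<close>

lemma eventually_le_powr_at_top:
  fixes a c :: real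
  assumes "0 < a"
  shows "\<forall>\<^sub>F x in at_top. c \<le> x powr a"
  using eventually_ge_at_top[of "max 1 c powr (1 / a)"]
proof eventually_elim
  case (elim x)
  have "c \<le> (max 1 c powr (1 / a)) powr a" using assms by (simp add: powr_powr)
  also have "\<dots> \<le> x powr a" using elim assms by (intro powr_mono2) auto
  finally show ?case .
qed

lemma dense_minor_of_graph_free:
  fixes G :: "'b ugraph" and H :: "'a ugraph" and \<beta> \<epsilon> \<theta> p s \<tau> :: real
  defines "d \<equiv> graph_density G"
  assumes G: "simple_graph G" "graph_free H G" and "1 \<le> d"
    and exponents: "0 < \<epsilon>" "\<epsilon> < 1" "s < 1" "0 < \<tau>" "1 < p" "\<tau> * \<epsilon> \<le> s / 2"
      "\<beta> \<le> 1 + \<tau> * (1 - \<epsilon>)" "(\<beta> + \<theta> + \<tau>) * (p - 1) \<le> 1 - s"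
    and turan: "\<And>n. n \<ge> n0 \<Longrightarrow> turan_number n H \<le> real n powr p"
    and large: "real n0 \<le> d powr (1 - s)" "round_cost \<epsilon> \<le> d powr (s / 2)"
      "2 * round_cost \<epsilon> \<le> d powr \<theta>"
  shows "\<exists>J :: 'b ugraph. simple_graph J \<and> is_minor J G \<and> d powr \<beta> \<le> graph_density J"
proof -
  have "finite (verts G)" using G(1) unfolding simple_graph_def by simp
  have "verts G \<noteq> {}" using \<open>1 \<le> d\<close> unfolding d_def graph_density_def by auto
  interpret contraction_process "edge_rel G" "verts G" "2 * d" "2 * d powr (1 - s)"
    "d powr (\<beta> + \<theta> + \<tau>)" "2 * d powr \<beta>" "d powr \<tau>" \<epsilon>
  proof
    show "sparse_upto (edge_rel G) (d powr (\<beta> + \<theta> + \<tau>)) (2 * d powr (1 - s))"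
    proof (rule sparse_upto_edge_rel[OF G \<open>1 < p\<close> turan large(1)])
      show "(d powr (\<beta> + \<theta> + \<tau>)) powr (p - 1) \<le> d powr (1 - s)"
        unfolding powr_powr using exponents(8) \<open>1 \<le> d\<close> by (rule powr_mono)
    qed
    show "2 * d * card (verts G) \<le> card (edge_rel G)"
      using card_edge_rel[OF G(1)] \<open>finite (verts G)\<close> \<open>verts G \<noteq> {}\<close>
      unfolding d_def graph_density_def by simp
    have "1 \<le> d powr (1 - s)" "1 \<le> d powr \<tau>"
      using \<open>1 \<le> d\<close> exponents(3,4) by (simp_all add: ge_one_powr_ge_zero)
    then show "1 \<le> 2 * d powr (1 - s)" "1 \<le> d powr \<tau>" by simp_all
    have "round_cost \<epsilon> * (2 * d powr (1 - s)) * (d powr \<tau>) powr \<epsilon>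
        \<le> d powr (s / 2) * (2 * d powr (1 - s)) * d powr (s / 2)"
      unfolding powr_powr using \<open>1 \<le> d\<close> large(2) exponents(6)
      by (intro mult_mono powr_mono) (auto simp: round_cost_def)
    also have "\<dots> = 2 * d powr (s / 2 + (1 - s) + s / 2)" by (simp only: powr_add mult_ac)
    also have "\<dots> = 2 * d" using \<open>1 \<le> d\<close> by simp
    finally show "round_cost \<epsilon> * (2 * d powr (1 - s)) * (d powr \<tau>) powr \<epsilon> \<le> 2 * d" .
    have "round_cost \<epsilon> * (2 * d powr \<beta>) * d powr \<tau> = (2 * round_cost \<epsilon>) * (d powr \<beta> * d powr \<tau>)"
      by simp
    also have "\<dots> \<le> d powr \<theta> * (d powr \<beta> * d powr \<tau>)" using large(3) by (rule mult_right_mono) simp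
    also have "\<dots> = d powr (\<beta> + \<theta> + \<tau>)" by (simp only: powr_add mult_ac)
    finally show "round_cost \<epsilon> * (2 * d powr \<beta>) * d powr \<tau> \<le> d powr (\<beta> + \<theta> + \<tau>)" .
    have "d powr \<beta> \<le> d powr (1 + \<tau> * (1 - \<epsilon>))" using exponents(7) \<open>1 \<le> d\<close> by (rule powr_mono)
    also have "\<dots> = d * (d powr \<tau>) powr (1 - \<epsilon>)" using \<open>1 \<le> d\<close> by (simp add: powr_add powr_powr)
    finally show "2 * d powr \<beta> \<le> 2 * d * (d powr \<tau>) powr (1 - \<epsilon>)" by simp
  qed (use exponents \<open>finite (verts G)\<close> \<open>verts G \<noteq> {}\<close> in
      \<open>simp_all add: edge_rel_subset irrefl_edge_rel sym_edge_rel G(1)\<close>)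
  show ?thesis using ex_dense_contraction ex_minor_if_dense_contraction by blast
qed

text \<open>With branch sets of size about \<open>d powr \<tau>\<close>, the density grows to about \<open>d powr (1 + \<tau>)\<close>, and the
  sparseness of \<open>G\<close> is exploited on sets of size about \<open>d powr (\<kappa> + \<tau>)\<close>. Both \<open>1 + \<tau>\<close> and
  \<open>(\<kappa> + \<tau>) * (\<gamma> - 1)\<close> fall short of their limits \<open>\<kappa>\<close> and \<open>1\<close> by a multiple of \<open>\<theta>\<close>.\<close>

lemma ex_exponents:
  fixes \<gamma> \<theta> :: real
  defines "\<kappa> \<equiv> \<gamma> / (2 * (\<gamma> - 1))"
  assumes "1 < \<gamma>" "0 < \<theta>" "1 < \<kappa> - \<theta>"
  obtains p \<epsilon> s \<tau> where "\<gamma> < p" "0 < \<epsilon>" "\<epsilon> < 1" "0 < s" "s < 1" "0 < \<tau>" "\<tau> * \<epsilon> \<le> s / 2"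
    "\<kappa> - \<theta> \<le> 1 + \<tau> * (1 - \<epsilon>)" "(\<kappa> + \<tau>) * (p - 1) = 1 - s"
proof -
  define \<tau> where "\<tau> = \<kappa> - 1 - \<theta> / 2"
  define s where "s = \<theta> * (\<gamma> - 1) / 4"
  define \<epsilon> where "\<epsilon> = min (1 / 2) (min (\<theta> / (2 * \<tau>)) (s / (2 * \<tau>)))"
  define p where "p = \<gamma> + s / (\<kappa> + \<tau>)"
  have pos: "0 < \<tau>" "0 < s" "0 < \<kappa> + \<tau>" using assms(2-4) unfolding \<tau>_def s_def by auto
  then have \<epsilon>: "0 < \<epsilon>" "\<epsilon> < 1" using assms(3) unfolding \<epsilon>_def by auto
  have "\<tau> * \<epsilon> \<le> \<tau> * (\<theta> / (2 * \<tau>))" "\<tau> * \<epsilon> \<le> \<tau> * (s / (2 * \<tau>))"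
    using pos unfolding \<epsilon>_def by (intro mult_left_mono; simp)+
  then have \<tau>\<epsilon>: "\<tau> * \<epsilon> \<le> \<theta> / 2" "\<tau> * \<epsilon> \<le> s / 2" using pos by simp_all
  have "(2 * \<kappa> - 1) * (\<gamma> - 1) = 1" unfolding \<kappa>_def using assms(2) by (simp add: field_simps)
  then have \<kappa>\<tau>: "(\<kappa> + \<tau>) * (\<gamma> - 1) = 1 - 2 * s" unfolding \<tau>_def s_def by (simp add: field_simps)
  have "(\<kappa> + \<tau>) * (p - 1) = (\<kappa> + \<tau>) * (\<gamma> - 1) + s"
    unfolding p_def using pos by (simp add: field_simps)
  then have "(\<kappa> + \<tau>) * (p - 1) = 1 - s" using \<kappa>\<tau> by simp
  moreover have "s < 1" using \<kappa>\<tau> pos assms(2) mult_pos_pos[of "\<kappa> + \<tau>" "\<gamma> - 1"] by linarith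
  moreover have "\<kappa> - \<theta> \<le> 1 + \<tau> * (1 - \<epsilon>)"
  proof -
    have "\<kappa> = 1 + \<tau> + \<theta> / 2" unfolding \<tau>_def by simp
    then show ?thesis using \<tau>\<epsilon>(1) by (simp add: right_diff_distrib)
  qed
  moreover have "\<gamma> < p" unfolding p_def using pos by simp
  ultimately show thesis using that pos \<epsilon> \<tau>\<epsilon>(2) by blast
qed

lemma eventually_dense_minor:
  fixes H :: "'a ugraph" and \<theta> :: real
  defines "\<kappa> \<equiv> turan_exponent H / (2 * (turan_exponent H - 1))"
  assumes "1 < turan_exponent H" "0 < \<theta>"
  shows "\<forall>\<^sub>F d in at_top. \<forall>G :: 'b ugraph. simple_graph G \<and> graph_free H G \<and> graph_density G = d \<longrightarrow>
    (\<exists>J :: 'b ugraph. simple_graph J \<and> is_minor J G \<and> d powr (\<kappa> - \<theta>) \<le> graph_density J)"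
proof (cases "\<kappa> - \<theta> \<le> 1")
  case True
  show ?thesis
    using eventually_ge_at_top[of 1]
  proof eventually_elim
    case (elim d)
    have "d powr (\<kappa> - \<theta>) \<le> d" using powr_mono[OF True elim] elim by simp
    then show ?case using is_minor_refl by blast
  qed
next
  case False
  obtain p \<epsilon> s \<tau> where "turan_exponent H < p" and exponents: "0 < \<epsilon>" "\<epsilon> < 1" "0 < s" "s < 1" "0 < \<tau>"
      "\<tau> * \<epsilon> \<le> s / 2" "\<kappa> - \<theta> \<le> 1 + \<tau> * (1 - \<epsilon>)" "(\<kappa> + \<tau>) * (p - 1) = 1 - s"
    using ex_exponents[OF assms(2,3), folded \<kappa>_def] False by (metis not_le)
  obtain n0 where n0: "\<And>n. n \<ge> n0 \<Longrightarrow> turan_number n H \<le> real n powr p"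
    using eventually_turan_number_le[OF assms(2) \<open>turan_exponent H < p\<close>]
    unfolding eventually_sequentially by blast
  have "0 < s / 2" "0 < 1 - s" using exponents by simp_all
  from eventually_ge_at_top[of 1] eventually_le_powr_at_top[OF \<open>0 < 1 - s\<close>, of "real n0"]
    eventually_le_powr_at_top[OF \<open>0 < s / 2\<close>, of "round_cost \<epsilon>"]
    eventually_le_powr_at_top[OF \<open>0 < \<theta>\<close>, of "2 * round_cost \<epsilon>"]
  show ?thesis
  proof eventually_elim
    case (elim d)
    show ?case
    proof (intro allI impI, elim conjE)
      fix G :: "'b ugraph"
      assume G: "simple_graph G" "graph_free H G" "graph_density G = d"
      show "\<exists>J :: 'b ugraph. simple_graph J \<and> is_minor J G \<and> d powr (\<kappa> - \<theta>) \<le> graph_density J"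
        using dense_minor_of_graph_free[OF G(1,2), of \<epsilon> s \<tau> p "\<kappa> - \<theta>" \<theta> n0] elim n0 exponents
          assms(2) \<open>turan_exponent H < p\<close> unfolding G(3) by simp
    qed
  qed
qed

lemma ex_vanishing_error:
  fixes P :: "real \<Rightarrow> real \<Rightarrow> bool"
  assumes "\<And>e. 0 < e \<Longrightarrow> \<forall>\<^sub>F x in at_top. P x e" and "\<And>x. \<exists>e. P x e"
  obtains \<epsilon> where "(\<epsilon> \<longlongrightarrow> 0) at_top" "\<And>x. P x (\<epsilon> x)"
proof -
  define errors where "errors x = {\<bar>e\<bar> | e. P x e}" for x
  have errors: "bdd_below (errors x)" "errors x \<noteq> {}" for x
    using assms(2)[of x] unfolding errors_def by (auto intro!: bdd_belowI[of _ 0])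
  have "\<exists>e. P x e \<and> \<bar>e\<bar> < Inf (errors x) + 1 / max 1 x" for x
    using cInf_less_iff[OF errors(2,1), of x "Inf (errors x) + 1 / max 1 x"]
    unfolding errors_def by auto
  then obtain \<epsilon> where \<epsilon>: "\<And>x. P x (\<epsilon> x)" "\<And>x. \<bar>\<epsilon> x\<bar> < Inf (errors x) + 1 / max 1 x"
    by metis
  have "(\<epsilon> \<longlongrightarrow> 0) at_top"
  proof (rule tendstoI)
    fix r :: real assume "0 < r"
    then have "\<forall>\<^sub>F x in at_top. P x (r / 2)" by (intro assms(1)) simp
    then show "\<forall>\<^sub>F x in at_top. dist (\<epsilon> x) 0 < r"
      using eventually_gt_at_top[of "max 1 (2 / r)"]
    proof eventually_elim
      case (elim x)
      have "\<bar>r / 2\<bar> \<in> errors x" using elim(1) unfolding errors_def by blast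
      then have "Inf (errors x) \<le> r / 2" using cInf_lower[OF _ errors(1)] \<open>0 < r\<close> by fastforce
      moreover have "1 / max 1 x < r / 2" using elim(2) \<open>0 < r\<close> by (simp add: field_simps)
      ultimately show ?case using \<epsilon>(2)[of x] by (simp add: dist_real_def)
    qed
  qed
  then show thesis using that \<epsilon>(1) by blast
qed

theorem theorem5p3:
  fixes H :: "'a ugraph"
  assumes "simple_graph H"
    and "bipartite H"
    and "turan_exponent H > 1"
  shows "\<exists>\<epsilon> :: real \<Rightarrow> real. (\<epsilon> \<longlongrightarrow> 0) at_top \<and>
    (\<forall>G :: 'b ugraph. simple_graph G \<and> graph_free H G \<longrightarrow>
      (\<exists>J :: 'b ugraph. simple_graph J \<and> is_minor J G \<and>
        graph_density J \<ge>
          graph_density G powr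
            (turan_exponent H / (2 * (turan_exponent H - 1)) - \<epsilon> (graph_density G))))"
proof -
  define \<kappa> where "\<kappa> = turan_exponent H / (2 * (turan_exponent H - 1))"
  define attains where "attains d e \<longleftrightarrow> (\<forall>G :: 'b ugraph.
    simple_graph G \<and> graph_free H G \<and> graph_density G = d \<longrightarrow>
    (\<exists>J :: 'b ugraph. simple_graph J \<and> is_minor J G \<and> d powr (\<kappa> - e) \<le> graph_density J))" for d e
  have "\<forall>\<^sub>F d in at_top. attains d e" if "0 < e" for e
    using eventually_dense_minor[OF assms(3) that, where 'b = 'b] unfolding attains_def \<kappa>_def .
  moreover have "attains d (\<kappa> - 1)" for d
  proof -
    have "graph_density G powr (\<kappa> - (\<kappa> - 1)) \<le> graph_density G" for G :: "'b ugraph"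
      by (simp add: graph_density_def)
    then show ?thesis unfolding attains_def using is_minor_refl by blast
  qed
  ultimately obtain \<epsilon> where "(\<epsilon> \<longlongrightarrow> 0) at_top" "\<And>d. attains d (\<epsilon> d)"
    using ex_vanishing_error[of attains] by blast
  then show ?thesis unfolding attains_def \<kappa>_def by blast
qed

end
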